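(* There is a rank-one free infinite measure preserving action $T$ of the discrete Heisenberg group $H_3(\mathbb Z)$ such that $\mathcal R(T)=\mathcal Ri(T)=\{\theta_t\mid t\in\mathbb R\}\cup\{\theta_\infty\}=\mathcal{ER}(T)=\mathcal{ER}i(T)$.
   Context: $H_3(\mathbb R)$ is the group of real upper triangular $3\times3$ matrices with ones on the diagonal, $H_3(\mathbb Z)$ its subgroup (a lattice) of matrices with integer entries, and $\mathfrak h_3(\mathbb R)$ the Lie algebra of $H_3(\mathbb R)$ (strictly upper triangular real $3\times 3$ matrices). $P(\mathfrak h_3(\mathbb R))$ is the set of lines (1-dimensional linear subspaces) in $\mathfrak h_3(\mathbb R)$; $H_3(\mathbb R)$ acts on it via the adjoint representation. For a line $\theta$, $\exp(\theta)=\{\exp(v):v\in\theta\}\subset H_3(\mathbb R)$. A right-invariant metric $\mathrm{dist}$ on $H_3(\mathbb R)$ compatible with the topology is fixed. For $t\in\mathbb R$, $\theta_t$ is the line spanned by $\begin{pmatrix}0&1&t\\0&0&0\\0&0&0\end{pmatrix}$, and $\theta_\infty$ is the line spanned by $\begin{pmatrix}0&0&1\\0&0&0\\0&0&0\end{pmatrix}$. Actions are measure preserving actions $T=(T_\gamma)_{\gamma\in H_3(\mathbb Z)}$ on $\sigma$-finite standard measure spaces $(X,\mathfrak B,\mu)$; infinite measure preserving means $\mu(X)=\infty$; free means that for each $\gamma\ne1$, $T_\gamma x\ne x$ for a.e. $x$. $T$ is recurrent along $\theta$ if for each $\epsilon>0$ and every $A\in\mathfrak B$ with $\mu(A)>0$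 there are $\gamma\in H_3(\mathbb Z)\setminus\{1\}$ and $g\in\exp(\theta)$ such that $\mathrm{dist}(\gamma,g)<\epsilon$ and $\mu(A\cap T_\gamma A)>0$. $T$ is rigid along $\theta$ if there is a sequence $(\gamma_n)_{n\ge1}$ in $H_3(\mathbb Z)$ with $\gamma_n\to\infty$ such that $\lim_{n\to\infty}\inf_{g\in\exp(\theta)}\mathrm{dist}(\gamma_n,g)=0$ and $\lim_{n\to\infty}\mu(A\cap T_{\gamma_n}A)=\mu(A)$ for each $A\in\mathfrak B$ with $\mu(A)<\infty$. $T$ is evenly recurrent (evenly rigid) along $\theta$ if $T$ is recurrent (rigid) along every line from the $H_3(\mathbb R)$-orbit of $\theta$. $\mathcal R(T)$, $\mathcal Ri(T)$, $\mathcal{ER}(T)$, $\mathcal{ER}i(T)$ are the sets of all $\theta\in P(\mathfrak h_3(\mathbb R))$ such that $T$ is, respectively, recurrent, rigid, evenly recurrent, evenly rigid along $\theta$. Rank one: there are a Følner sequence $(F_n)$ of finite subsets of $H_3(\mathbb Z)$ and measurable sets $B_n\subset X$ with $0<\mu(B_n)<\infty$ such that for each $n$ the sets $T_\gamma B_n$, $\gamma\in F_n$, are pairwise disjoint, and for every measurable $A\subset X$ with $\mu(A)<\infty$, $\lim_{n\to\infty}\min_{F\subset F_n}\mu\big(A\,\triangle\,\bigsqcup_{\gamma\in F}T_\gamma B_n\big)=0$. *)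

theory Defs
  imports "HOL-Analysis.Analysis"
begin

section \<open>The Heisenberg group and its Lie algebra\<close>

text \<open>Conditions on matrices are written out entry by entry: in the index type \<open>3\<close> the
  numeral \<open>3\<close> equals \<open>0\<close>, so the order of that type is not the order \<open>1 < 2 < 3\<close>.\<close>

definition H3R :: "(real^3^3) set" where
  "H3R = {A. A$1$1 = 1 \<and> A$2$2 = 1 \<and> A$3$3 = 1 \<and> A$2$1 = 0 \<and> A$3$1 = 0 \<and> A$3$2 = 0}"

definition H3Z :: "(real^3^3) set" where
  "H3Z = {A \<in> H3R. \<forall>i j. A$i$j \<in> \<int>}"

definition h3R :: "(real^3^3) set" where
  "h3R = {A. A$1$1 = 0 \<and> A$2$2 = 0 \<and> A$3$3 = 0 \<and> A$2$1 = 0 \<and> A$3$1 = 0 \<and> A$3$2 = 0}"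

text \<open>The matrix exponential; the constant \<open>exp\<close> of the library does not apply, since
  multiplication in the type \<open>real^3^3\<close> is componentwise.\<close>

definition mexp :: "real^3^3 \<Rightarrow> real^3^3" where
  "mexp A = (\<Sum>n. (((\<lambda>B. A ** B) ^^ n) (mat 1)) /\<^sub>R fact n)"

definition P_h3R :: "(real^3^3) set set" where
  "P_h3R = {\<theta>. subspace \<theta> \<and> \<theta> \<subseteq> h3R \<and> dim \<theta> = 1}"

definition Ad :: "real^3^3 \<Rightarrow> real^3^3 \<Rightarrow> real^3^3" where
  "Ad g v = g ** v ** matrix_inv g"

definition line_orbit :: "(real^3^3) set \<Rightarrow> (real^3^3) set set" where
  "line_orbit \<theta> = {Ad g ` \<theta> | g. g \<in> H3R}"

definition theta :: "real \<Rightarrow> (real^3^3) set" where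
  "theta t = span {vector [vector [0, 1, t], vector [0, 0, 0], vector [0, 0, 0]]}"

definition theta_infinity :: "(real^3^3) set" where
  "theta_infinity = span {vector [vector [0, 0, 1], vector [0, 0, 0], vector [0, 0, 0]]}"

text \<open>A metric on \<open>H3R\<close> is a function on the whole type of which only the values on \<open>H3R\<close>
  matter; \<open>Metric_space\<close> also asks for nonnegativity and symmetry elsewhere, which
  extension by \<open>0\<close> provides.\<close>

definition right_invariant_compatible_metric :: "(real^3^3 \<Rightarrow> real^3^3 \<Rightarrow> real) \<Rightarrow> bool" where
  "right_invariant_compatible_metric d \<longleftrightarrow>
     Metric_space H3R d \<and>
     Metric_space.mtopology H3R d = top_of_set H3R \<and>
     (\<forall>g\<in>H3R. \<forall>h\<in>H3R. \<forall>k\<in>H3R. d (g ** k) (h ** k) = d g h)"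

section \<open>Measure preserving actions\<close>

definition standard_borel_measure :: "'a measure \<Rightarrow> bool" where
  "standard_borel_measure M \<longleftrightarrow>
     (\<exists>X. completely_metrizable_space X \<and> second_countable X \<and>
          topspace X = space M \<and> sets M = sigma_sets (space M) {U. openin X U})"

definition mp_action :: "'a measure \<Rightarrow> (real^3^3 \<Rightarrow> 'a \<Rightarrow> 'a) \<Rightarrow> bool" where
  "mp_action M T \<longleftrightarrow>
     (\<forall>\<gamma>\<in>H3Z. T \<gamma> \<in> measurable M M \<and> distr M M (T \<gamma>) = M) \<and>
     (\<forall>x\<in>space M. T (mat 1) x = x) \<and>
     (\<forall>\<gamma>\<in>H3Z. \<forall>\<delta>\<in>H3Z. \<forall>x\<in>space M. T (\<gamma> ** \<delta>) x = T \<gamma> (T \<delta> x))"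

definition free_action :: "'a measure \<Rightarrow> (real^3^3 \<Rightarrow> 'a \<Rightarrow> 'a) \<Rightarrow> bool" where
  "free_action M T \<longleftrightarrow> (\<forall>\<gamma>\<in>H3Z - {mat 1}. AE x in M. T \<gamma> x \<noteq> x)"

text \<open>Left Foelner sequences, the relevant side for towers \<open>T \<gamma> ` B\<close> of a left action.\<close>

definition Folner_sequence :: "(nat \<Rightarrow> (real^3^3) set) \<Rightarrow> bool" where
  "Folner_sequence F \<longleftrightarrow>
     (\<forall>n. finite (F n) \<and> F n \<noteq> {} \<and> F n \<subseteq> H3Z) \<and>
     (\<forall>\<gamma>\<in>H3Z. (\<lambda>n. real (card (sym_diff ((\<lambda>\<delta>. \<gamma> ** \<delta>) ` F n) (F n))) / real (card (F n)))
        \<longlonglongrightarrow> 0)"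

definition rank_one :: "'a measure \<Rightarrow> (real^3^3 \<Rightarrow> 'a \<Rightarrow> 'a) \<Rightarrow> bool" where
  "rank_one M T \<longleftrightarrow>
     (\<exists>F B. Folner_sequence F \<and>
        (\<forall>n. B n \<in> sets M \<and> 0 < emeasure M (B n) \<and> emeasure M (B n) < \<infinity>) \<and>
        (\<forall>n. disjoint_family_on (\<lambda>\<gamma>. T \<gamma> ` B n) (F n)) \<and>
        (\<forall>A\<in>sets M. emeasure M A < \<infinity> \<longrightarrow>
           (\<lambda>n. Min ((\<lambda>F'. emeasure M (sym_diff A (\<Union>\<gamma>\<in>F'. T \<gamma> ` B n))) ` Pow (F n)))
             \<longlonglongrightarrow> 0))"

section \<open>Directional recurrence and rigidity\<close>

definition recurrent_along ::
  "(real^3^3 \<Rightarrow> real^3^3 \<Rightarrow> real) \<Rightarrow> 'a measure \<Rightarrow> (real^3^3 \<Rightarrow> 'a \<Rightarrow> 'a) \<Rightarrow>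
   (real^3^3) set \<Rightarrow> bool" where
  "recurrent_along d M T \<theta> \<longleftrightarrow>
     (\<forall>\<epsilon>>0. \<forall>A\<in>sets M. emeasure M A > 0 \<longrightarrow>
        (\<exists>\<gamma>\<in>H3Z - {mat 1}. \<exists>g\<in>mexp ` \<theta>. d \<gamma> g < \<epsilon> \<and> emeasure M (A \<inter> T \<gamma> ` A) > 0))"

text \<open>For a sequence \<open>s\<close> in the discrete group \<open>H3Z\<close>, convergence to infinity means that \<open>s\<close>
  eventually leaves every finite set, that is, convergence along the filter \<open>cofinite\<close>.\<close>

definition rigid_along ::
  "(real^3^3 \<Rightarrow> real^3^3 \<Rightarrow> real) \<Rightarrow> 'a measure \<Rightarrow> (real^3^3 \<Rightarrow> 'a \<Rightarrow> 'a) \<Rightarrow>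
   (real^3^3) set \<Rightarrow> bool" where
  "rigid_along d M T \<theta> \<longleftrightarrow>
     (\<exists>s :: nat \<Rightarrow> real^3^3.
        (\<forall>n. s n \<in> H3Z) \<and> filterlim s cofinite sequentially \<and>
        (\<lambda>n. INF g\<in>mexp ` \<theta>. d (s n) g) \<longlonglongrightarrow> 0 \<and>
        (\<forall>A\<in>sets M. emeasure M A < \<infinity> \<longrightarrow>
           (\<lambda>n. emeasure M (A \<inter> T (s n) ` A)) \<longlonglongrightarrow> emeasure M A))"

definition Rec ::
  "(real^3^3 \<Rightarrow> real^3^3 \<Rightarrow> real) \<Rightarrow> 'a measure \<Rightarrow> (real^3^3 \<Rightarrow> 'a \<Rightarrow> 'a) \<Rightarrow>
   (real^3^3) set set" where
  "Rec d M T = {\<theta> \<in> P_h3R. recurrent_along d M T \<theta>}"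

definition Rig ::
  "(real^3^3 \<Rightarrow> real^3^3 \<Rightarrow> real) \<Rightarrow> 'a measure \<Rightarrow> (real^3^3 \<Rightarrow> 'a \<Rightarrow> 'a) \<Rightarrow>
   (real^3^3) set set" where
  "Rig d M T = {\<theta> \<in> P_h3R. rigid_along d M T \<theta>}"

definition Even_Rec ::
  "(real^3^3 \<Rightarrow> real^3^3 \<Rightarrow> real) \<Rightarrow> 'a measure \<Rightarrow> (real^3^3 \<Rightarrow> 'a \<Rightarrow> 'a) \<Rightarrow>
   (real^3^3) set set" where
  "Even_Rec d M T = {\<theta> \<in> P_h3R. \<forall>\<theta>'\<in>line_orbit \<theta>. recurrent_along d M T \<theta>'}"

definition Even_Rig ::
  "(real^3^3 \<Rightarrow> real^3^3 \<Rightarrow> real) \<Rightarrow> 'a measure \<Rightarrow> (real^3^3 \<Rightarrow> 'a \<Rightarrow> 'a) \<Rightarrow>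
   (real^3^3) set set" where
  "Even_Rig d M T = {\<theta> \<in> P_h3R. \<forall>\<theta>'\<in>line_orbit \<theta>. rigid_along d M T \<theta>'}"

end

theory Submission
  imports Defs "HOL-Probability.Probability" "HOL-Number_Theory.Cong" "HOL-Real_Asymp.Real_Asymp"
begin

text \<open>Recurrence along a line spanned by a matrix with nonzero entry at position \<open>(2,3)\<close> forces return
  times \<open>\<gamma>\<close> outside the abelian normal subgroup \<open>N = {\<gamma> \<in> H3Z. \<gamma>$2$3 = 0}\<close>, whereas the lines of
  \<open>theta\<close> and \<open>theta_infinity\<close> are those in the Lie algebra of \<open>N\<close>. So one induces to \<open>H3Z\<close> a
  probability preserving action of \<open>N\<close>, isomorphic to \<open>\<int>\<^sup>2\<close>: the induced space \<open>Y \<times> \<int>\<close> has infinite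
  measure, and \<open>Y \<times> {0}\<close> is disjoint from its translates by elements outside \<open>N\<close>. Taking for \<open>Y\<close> an
  odometer, with levels modulo \<open>h n\<close>, the action along \<open>N\<close> is nearly trivial on \<open>(h n \<int>)\<^sup>2\<close> and on all
  of its conjugates at once, and by Dirichlet's theorem this lattice comes arbitrarily close to every
  line. The boxes of side \<open>h n\<close> in \<open>N\<close>, thickened by \<open>n\<close> in the remaining direction, are Foelner sets,
  and they provide rank one.\<close>

section \<open>Heisenberg group and directions\<close>

text \<open>The obstacle is that rigidity has to hold on all fibres of the induced space at once. On
  fibre \<open>k\<close> the element \<open>heis a 0 c\<close> acts through the translation by
  \<open>(a, c + a * k)\<close>, so times that are good for one fibre may be bad for the others.
  Divisibility of \<open>a\<close> and \<open>c\<close> by \<open>h n\<close> passes to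
  \<open>c + a * k\<close> for every \<open>k\<close>, and so a single sequence serves all fibres.
  The moduli are pairwise coprime because then, by the Chinese remainder theorem, the first
  \<open>n\<close> coordinates of a point of the odometer amount to one pair of residues modulo
  \<open>h n\<close>. A box of side \<open>h n\<close> in \<open>N\<close> therefore meets each of
  the corresponding cylinders exactly once. Returns in \<open>N\<close> do not help the other lines:
  a point of such a one-parameter subgroup that is close to \<open>N\<close> has a small parameter,
  hence is close to the identity, and discreteness leaves only the trivial element. The same shear
  threatens the Foelner property, as left multiplication moves the corner entry by up to
  \<open>|a| * n\<close>. It is harmless since \<open>h n\<close> is at least
  \<open>2 ^ n\<close>.\<close>

definition heis :: "real \<Rightarrow> real \<Rightarrow> real \<Rightarrow> real^3^3" where
  "heis a b c = vector [vector [1, a, c], vector [0, 1, b], vector [0, 0, 1]]"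

definition lie :: "real \<Rightarrow> real \<Rightarrow> real \<Rightarrow> real^3^3" where
  "lie a b c = vector [vector [0, a, c], vector [0, 0, b], vector [0, 0, 0]]"

lemma mat3_eq_iff:
  fixes A B :: "real^3^3"
  shows "A = B \<longleftrightarrow> A$1$1 = B$1$1 \<and> A$1$2 = B$1$2 \<and> A$1$3 = B$1$3 \<and>
    A$2$1 = B$2$1 \<and> A$2$2 = B$2$2 \<and> A$2$3 = B$2$3 \<and>
    A$3$1 = B$3$1 \<and> A$3$2 = B$3$2 \<and> A$3$3 = B$3$3"
  by (auto simp: vec_eq_iff forall_3)

lemma heis_nth [simp]:
  "heis a b c $1$1 = 1" "heis a b c $1$2 = a" "heis a b c $1$3 = c"
  "heis a b c $2$1 = 0" "heis a b c $2$2 = 1" "heis a b c $2$3 = b"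
  "heis a b c $3$1 = 0" "heis a b c $3$2 = 0" "heis a b c $3$3 = 1"
  by (simp_all add: heis_def)

lemma lie_nth [simp]:
  "lie a b c $1$1 = 0" "lie a b c $1$2 = a" "lie a b c $1$3 = c"
  "lie a b c $2$1 = 0" "lie a b c $2$2 = 0" "lie a b c $2$3 = b"
  "lie a b c $3$1 = 0" "lie a b c $3$2 = 0" "lie a b c $3$3 = 0"
  by (simp_all add: lie_def)

lemma mat_1_nth_3 [simp]:
  "(mat 1 :: real^3^3) $1$1 = 1" "(mat 1 :: real^3^3) $1$2 = 0" "(mat 1 :: real^3^3) $1$3 = 0"
  "(mat 1 :: real^3^3) $2$1 = 0" "(mat 1 :: real^3^3) $2$2 = 1" "(mat 1 :: real^3^3) $2$3 = 0"
  "(mat 1 :: real^3^3) $3$1 = 0" "(mat 1 :: real^3^3) $3$2 = 0" "(mat 1 :: real^3^3) $3$3 = 1"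
  by (simp_all add: mat_def)

lemma heis_0: "heis 0 0 0 = mat 1"
  by (simp add: mat3_eq_iff)

lemma heis_eq_iff [simp]: "heis a b c = heis a' b' c' \<longleftrightarrow> a = a' \<and> b = b' \<and> c = c'"
  by (auto simp: mat3_eq_iff)

lemma heis_eq_1_iff [simp]: "heis a b c = mat 1 \<longleftrightarrow> a = 0 \<and> b = 0 \<and> c = 0"
  by (auto simp: mat3_eq_iff)

lemma lie_eq_iff [simp]: "lie a b c = lie a' b' c' \<longleftrightarrow> a = a' \<and> b = b' \<and> c = c'"
  by (auto simp: mat3_eq_iff)

lemma lie_eq_0_iff [simp]: "lie a b c = 0 \<longleftrightarrow> a = 0 \<and> b = 0 \<and> c = 0"
  by (auto simp: mat3_eq_iff)

lemma scaleR_lie: "s *\<^sub>R lie a b c = lie (s * a) (s * b) (s * c)"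
  by (simp add: mat3_eq_iff)

lemma heis_mult: "heis a b c ** heis a' b' c' = heis (a + a') (b + b') (c + c' + a * b')"
  by (simp add: mat3_eq_iff matrix_matrix_mult_def sum_3)

lemma heis_in_H3R [simp]: "heis a b c \<in> H3R"
  by (simp add: H3R_def)

lemma H3R_E:
  assumes "A \<in> H3R" obtains a b c where "A = heis a b c"
  using that[of "A$1$2" "A$2$3" "A$1$3"] assms by (simp add: H3R_def mat3_eq_iff)

lemma heis_in_H3Z [simp]: "heis a b c \<in> H3Z \<longleftrightarrow> a \<in> \<int> \<and> b \<in> \<int> \<and> c \<in> \<int>"
  by (auto simp: H3Z_def forall_3)

lemma H3Z_E:
  assumes "A \<in> H3Z"
  obtains a b c :: int where "A = heis (of_int a) (of_int b) (of_int c)"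
proof -
  obtain a b c where A: "A = heis a b c"
    using assms H3R_E unfolding H3Z_def by blast
  with assms have "a \<in> \<int>" "b \<in> \<int>" "c \<in> \<int>" by simp_all
  then show ?thesis using that A by (metis Ints_cases)
qed

lemma h3R_E:
  assumes "v \<in> h3R" obtains a b c where "v = lie a b c"
  using that[of "v$1$2" "v$2$3" "v$1$3"] assms by (simp add: h3R_def mat3_eq_iff)

lemma lie_in_h3R [simp]: "lie a b c \<in> h3R"
  by (simp add: h3R_def)

lemma matrix_inv_heis: "matrix_inv (heis a b c) = heis (- a) (- b) (a * b - c)"
proof -
  let ?A = "heis a b c" and ?B = "heis (- a) (- b) (a * b - c)"
  have inv: "?A ** ?B = mat 1" "?B ** ?A = mat 1"
    by (simp_all add: heis_mult)
  then have "matrix_inv ?A ** ?A = mat 1"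
    unfolding matrix_inv_def by (metis (mono_tags, lifting) someI)
  then have "matrix_inv ?A ** (?A ** ?B) = ?B"
    by (simp add: matrix_mul_assoc)
  then show ?thesis by (simp add: inv)
qed

lemma Ad_heis_lie: "Ad (heis a b c) (lie p q r) = lie p q (r + a * q - b * p)"
  by (simp add: Ad_def matrix_inv_heis mat3_eq_iff matrix_matrix_mult_def sum_3 algebra_simps)

text \<open>A strictly upper triangular matrix of size 3 has cube zero. The series stops at the
  square, whose only entry \<open>a * b\<close> sits in the corner and brings in the one
  half.\<close>

lemma mexp_lie: "mexp (lie a b c) = heis a b (c + a * b / 2)"
proof -
  let ?f = "\<lambda>n. (((\<lambda>B. lie a b c ** B) ^^ n) (mat 1)) /\<^sub>R fact n"
  have 2: "((\<lambda>B. lie a b c ** B) ^^ 2) (mat 1) = lie 0 0 (a * b)"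
    by (simp add: mat3_eq_iff numeral_2_eq_2 matrix_matrix_mult_def sum_3)
  have 3: "((\<lambda>B. lie a b c ** B) ^^ (n + 3)) (mat 1) = 0" for n
  proof (induction n)
    case 0
    have "((\<lambda>B. lie a b c ** B) ^^ 3) (mat 1) = lie a b c ** (((\<lambda>B. lie a b c ** B) ^^ 2) (mat 1))"
      by (simp add: numeral_3_eq_3 numeral_2_eq_2)
    also have "\<dots> = 0"
      unfolding 2 by (simp add: mat3_eq_iff matrix_matrix_mult_def sum_3)
    finally show ?case by simp
  next
    case (Suc n)
    then show ?case by (simp only: add_Suc funpow.simps o_def) simp
  qed
  have "?f n = 0" if "n \<notin> {..<3}" for n
    using 3[of "n - 3"] that by simp
  then have "mexp (lie a b c) = (\<Sum>n<3. ?f n)"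
    unfolding mexp_def by (intro suminf_finite) auto
  also have "\<dots> = mat 1 + lie a b c + lie 0 0 (a * b) /\<^sub>R 2"
    using 2 by (simp add: numeral_3_eq_3 numeral_2_eq_2)
  also have "\<dots> = heis a b (c + a * b / 2)"
    by (simp add: mat3_eq_iff)
  finally show ?thesis .
qed

lemma mexp_image_span: "mexp ` span {lie a b c} = range (\<lambda>s. heis (s * a) (s * b) (s * c + s\<^sup>2 * a * b / 2))"
  by (simp add: span_singleton scaleR_lie mexp_lie image_image power2_eq_square algebra_simps)

lemma P_h3R_E:
  assumes "\<theta> \<in> P_h3R"
  obtains a b c where "\<theta> = span {lie a b c}" "lie a b c \<noteq> 0"
proof -
  have \<theta>: "subspace \<theta>" "\<theta> \<subseteq> h3R" "dim \<theta> = 1"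
    using assms by (auto simp: P_h3R_def)
  obtain B where B: "B \<subseteq> \<theta>" "independent B" "\<theta> \<subseteq> span B" "card B = 1"
    using basis_exists[of \<theta>] \<theta>(3) by auto
  then obtain v where v: "B = {v}" by (auto simp: card_1_singleton_iff)
  then obtain a b c where "v = lie a b c" using B \<theta> h3R_E by blast
  moreover have "\<theta> = span B" using B \<theta> by (simp add: span_subspace)
  moreover have "v \<noteq> 0" using B v by (simp add: dependent_single)
  ultimately show ?thesis using that v by simp
qed

lemma span_lie_in_P_h3R:
  assumes "lie a b c \<noteq> 0" shows "span {lie a b c} \<in> P_h3R"
proof -
  have "dim (span {lie a b c}) = 1"
    using assms by (simp only: dim_span) (simp add: dim_insert)
  then show ?thesis
    using subspace_span[of "{lie a b c}"] by (auto simp: P_h3R_def span_singleton scaleR_lie)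
qed

lemma span_singleton_scale:
  fixes v :: "'a::real_vector"
  assumes "s \<noteq> 0" shows "span {s *\<^sub>R v} = span {v}"
proof -
  have "k *\<^sub>R v \<in> range (\<lambda>k. k *\<^sub>R (s *\<^sub>R v))" for k
    using assms by (intro image_eqI[of _ _ "k / s"]) auto
  then show ?thesis by (auto simp: span_singleton)
qed

lemma theta_eq: "theta t = span {lie 1 0 t}" and theta_infinity_eq: "theta_infinity = span {lie 0 0 1}"
  by (simp_all add: theta_def theta_infinity_def lie_def)

text \<open>Rescaling the spanning vector gives the slope \<open>c / a\<close> if \<open>a\<close>
  is nonzero, and the centre otherwise. The form with middle coefficient 0 is free of normalisation
  and is the one used from here on.\<close>

lemma horizontal_iff:
  "\<theta> \<in> range theta \<union> {theta_infinity} \<longleftrightarrow> (\<exists>a c. \<theta> = span {lie a 0 c} \<and> lie a 0 c \<noteq> 0)"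
proof
  assume "\<exists>a c. \<theta> = span {lie a 0 c} \<and> lie a 0 c \<noteq> 0"
  then obtain a c where ac: "\<theta> = span {lie a 0 c}" "a \<noteq> 0 \<or> c \<noteq> 0" by auto
  show "\<theta> \<in> range theta \<union> {theta_infinity}"
  proof (cases "a = 0")
    case True
    then have "\<theta> = theta_infinity"
      using ac span_singleton_scale[of c "lie 0 0 1"] by (simp add: theta_infinity_eq scaleR_lie)
    then show ?thesis by simp
  next
    case False
    then have "\<theta> = theta (c / a)"
      using ac span_singleton_scale[of a "lie 1 0 (c / a)"] by (simp add: theta_eq scaleR_lie)
    then show ?thesis by simp
  qed
next
  assume "\<theta> \<in> range theta \<union> {theta_infinity}"
  then consider t where "\<theta> = span {lie 1 0 t}" | "\<theta> = span {lie 0 0 1}"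
    by (auto simp: theta_eq theta_infinity_eq)
  then show "\<exists>a c. \<theta> = span {lie a 0 c} \<and> lie a 0 c \<noteq> 0"
    by cases (metis lie_eq_0_iff one_neq_zero)+
qed

lemma self_in_line_orbit:
  assumes "\<theta> \<in> P_h3R" shows "\<theta> \<in> line_orbit \<theta>"
proof -
  have "Ad (heis 0 0 0) v = v" if v: "v \<in> \<theta>" for v
  proof -
    have "v \<in> h3R" using v assms by (auto simp: P_h3R_def)
    then obtain a b c where "v = lie a b c" by (rule h3R_E)
    then show ?thesis by (simp add: Ad_heis_lie)
  qed
  then have "Ad (heis 0 0 0) ` \<theta> = \<theta>" by simp
  then show ?thesis unfolding line_orbit_def using heis_in_H3R by blast
qed

text \<open>The adjoint action changes only the corner entry, so it tilts a line within the plane of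
  vanishing (2,3) entry. This is why the even notions will coincide with the plain ones.\<close>

lemma line_orbit_horizontal:
  assumes "\<theta> \<in> range theta \<union> {theta_infinity}" "\<theta>' \<in> line_orbit \<theta>"
  shows "\<theta>' \<in> range theta \<union> {theta_infinity}"
proof -
  obtain a c where ac: "\<theta> = span {lie a 0 c}" "lie a 0 c \<noteq> 0"
    using assms(1) horizontal_iff by blast
  obtain p q r where "\<theta>' = Ad (heis p q r) ` \<theta>"
    using assms(2) unfolding line_orbit_def by (auto elim: H3R_E)
  then have "\<theta>' = span {lie a 0 (c - q * a)}"
    by (simp add: ac span_singleton scaleR_lie Ad_heis_lie image_image algebra_simps)
  moreover have "lie a 0 (c - q * a) \<noteq> 0" using ac(2) by auto
  ultimately show ?thesis using horizontal_iff by blast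
qed

section \<open>Integer points near lines, and right-invariant metrics\<close>

lemma filterlim_cofinite_iff:
  fixes f :: "'a \<Rightarrow> 'b"
  shows
  "filterlim f cofinite F \<longleftrightarrow> (\<forall>c. \<forall>\<^sub>F x in F. f x \<noteq> c)"
proof
  assume "filterlim f cofinite F"
  then show "\<forall>c. \<forall>\<^sub>F x in F. f x \<noteq> c"
  proof (intro allI)
    fix c :: 'b
    have "\<forall>\<^sub>F y in cofinite. y \<noteq> c" by (simp add: eventually_cofinite)
    then show "\<forall>\<^sub>F x in F. f x \<noteq> c"
      using \<open>filterlim f cofinite F\<close> by (rule eventually_compose_filterlim)
  qed
next
  assume "\<forall>c. \<forall>\<^sub>F x in F. f x \<noteq> c"
  then show "filterlim f cofinite F"
    unfolding filterlim_iff eventually_cofinite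
  proof (intro allI impI)
    fix P :: "'b \<Rightarrow> bool" assume "finite {y. \<not> P y}"
    then have "\<forall>\<^sub>F x in F. \<forall>c\<in>{y. \<not> P y}. f x \<noteq> c"
      using \<open>\<forall>c. \<forall>\<^sub>F x in F. f x \<noteq> c\<close> by (intro eventually_ball_finite) auto
    then show "\<forall>\<^sub>F x in F. P (f x)" by eventually_elim auto
  qed
qed

text \<open>Dirichlet's theorem gives \<open>q\<close> and \<open>p\<close> with error below
  \<open>1 / N\<close>. Multiplying both by \<open>h\<close> buys divisibility and multiplies the
  error by \<open>h\<close>, which the choice \<open>N > h / \<epsilon>\<close> absorbs.\<close>

lemma Dirichlet_approx_dvd:
  fixes t \<epsilon> :: real and h :: int
  assumes "\<epsilon> > 0" "h > 0"
  obtains a c :: int where "a \<noteq> 0" "h dvd a" "h dvd c" "\<bar>of_int c - t * of_int a\<bar> < \<epsilon>"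
proof -
  obtain N :: nat where N: "N > 0" "of_int h / \<epsilon> < N"
    using reals_Archimedean2[of "max 1 (of_int h / \<epsilon>)"]
    by (metis max_less_iff_conj of_nat_0_less_iff zero_less_one less_trans)
  obtain q p where qp: "0 < q" "q \<le> int N" "\<bar>of_int q * t - of_int p\<bar> < 1 / N"
    using Dirichlet_approx[OF N(1), of t] by metis
  have "\<bar>of_int (h * p) - t * of_int (h * q)\<bar> = of_int h * \<bar>of_int q * t - of_int p\<bar>"
  proof -
    have "of_int (h * p) - t * of_int (h * q) = of_int h * - (of_int q * t - of_int p)"
      by (simp add: algebra_simps)
    then show ?thesis using \<open>h > 0\<close> by (simp add: abs_mult)
  qed
  also have "\<dots> < of_int h * (1 / N)"
    using qp(3) \<open>h > 0\<close> by (intro mult_strict_left_mono) auto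
  also have "\<dots> < \<epsilon>"
    using N assms by (simp add: field_simps)
  finally show ?thesis
    using that[of "h * q" "h * p"] qp assms by simp
qed

locale right_invariant =
  fixes d :: "real^3^3 \<Rightarrow> real^3^3 \<Rightarrow> real"
  assumes ric: "right_invariant_compatible_metric d"
begin

sublocale Metric_space H3R d
  using ric by (simp add: right_invariant_compatible_metric_def)

lemma topology: "mtopology = top_of_set H3R"
  using ric by (simp add: right_invariant_compatible_metric_def)

text \<open>Right translation by the inverse of the second argument reduces every distance to one
  from the identity; the product term in the corner comes from multiplying by that inverse.\<close>

lemma dist_heis:
  "d (heis a b c) (heis a' b' c') = d (heis (a - a') (b - b') (c - c' - (a - a') * b')) (mat 1)"
proof -
  have "d (heis a b c) (heis a' b' c') =
      d (heis (a - a') (b - b') (c - c' - (a - a') * b') ** heis a' b' c') (mat 1 ** heis a' b' c')"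
    by (simp add: heis_mult)
  also have "\<dots> = d (heis (a - a') (b - b') (c - c' - (a - a') * b')) (mat 1)"
    using ric heis_in_H3R by (auto simp: right_invariant_compatible_metric_def simp flip: heis_0)
  finally show ?thesis .
qed

text \<open>Compatibility with the topology is exploited at the identity only. This half bounds
  distances from above and serves rigidity; the converse half, \<open>small_entries\<close>, serves
  non-recurrence.\<close>

lemma small_dist:
  assumes "\<epsilon> > 0"
  obtains \<delta> where "\<delta> > 0"
    "\<And>a b c. \<bar>a\<bar> < \<delta> \<Longrightarrow> \<bar>b\<bar> < \<delta> \<Longrightarrow> \<bar>c\<bar> < \<delta> \<Longrightarrow> d (heis a b c) (mat 1) < \<epsilon>"
proof -
  have 1: "mat 1 \<in> H3R" by (simp flip: heis_0)
  have "openin (top_of_set H3R) (mball (mat 1) \<epsilon>)"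
    using openin_mball topology by metis
  then obtain r where r: "r > 0" "\<And>A. A \<in> H3R \<Longrightarrow> dist A (mat 1) < r \<Longrightarrow> A \<in> mball (mat 1) \<epsilon>"
    using 1 assms centre_in_mball_iff[of "mat 1" \<epsilon>]
    by (meson openin_euclidean_subtopology_iff)
  \<comment> \<open>The Euclidean distance is at most the sum of the nine absolute entries, so
    \<open>r / 9\<close> is a safe bound for each.\<close>
  have "d (heis a b c) (mat 1) < \<epsilon>" if "\<bar>a\<bar> < r / 9" "\<bar>b\<bar> < r / 9" "\<bar>c\<bar> < r / 9" for a b c
  proof -
    have "dist (heis a b c) (mat 1) \<le> (\<Sum>i\<in>UNIV. norm ((heis a b c - mat 1) $ i))"
      unfolding dist_norm norm_vec_def by (intro L2_set_le_sum) auto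
    also have "\<dots> \<le> (\<Sum>i\<in>UNIV. \<Sum>j\<in>UNIV. \<bar>(heis a b c - mat 1) $ i $ j\<bar>)"
      by (intro sum_mono norm_le_l1_cart)
    also have "\<dots> < r"
      using that \<open>r > 0\<close> by (simp add: sum_3)
    finally have "heis a b c \<in> mball (mat 1) \<epsilon>" using r(2) heis_in_H3R by blast
    then show ?thesis by (simp add: commute)
  qed
  then show ?thesis using that[of "r / 9"] r(1) by simp
qed

lemma small_entries:
  assumes "\<delta> > 0"
  obtains \<epsilon> where "\<epsilon> > 0"
    "\<And>a b c. d (heis a b c) (mat 1) < \<epsilon> \<Longrightarrow> \<bar>a\<bar> < \<delta> \<and> \<bar>b\<bar> < \<delta> \<and> \<bar>c\<bar> < \<delta>"
proof -
  have 1: "mat 1 \<in> H3R" by (simp flip: heis_0)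
  have "openin mtopology (H3R \<inter> ball (mat 1) \<delta>)"
    unfolding topology by (simp add: openin_open_Int)
  then obtain r where r: "r > 0" "mball (mat 1) r \<subseteq> H3R \<inter> ball (mat 1) \<delta>"
    using 1 assms unfolding openin_mtopology by (metis IntI centre_in_ball)
  have "\<bar>a\<bar> < \<delta> \<and> \<bar>b\<bar> < \<delta> \<and> \<bar>c\<bar> < \<delta>" if "d (heis a b c) (mat 1) < r" for a b c
  proof -
    have "heis a b c \<in> mball (mat 1) r" using that 1 by (simp add: commute)
    then have "heis a b c \<in> ball (mat 1) \<delta>" using r(2) by blast
    then have *: "dist (heis a b c) (mat 1) < \<delta>" by (simp add: dist_commute)
    have "\<bar>(heis a b c - mat 1) $ i $ j\<bar> \<le> dist (heis a b c) (mat 1)" for i j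
      unfolding dist_norm by (rule order_trans[OF component_le_norm_cart Finite_Cartesian_Product.norm_nth_le])
    from this[of 1 2] this[of 2 3] this[of 1 3] show ?thesis
      using * by simp
  qed
  then show ?thesis using that r(1) by blast
qed

text \<open>Wandering forces a return time \<open>\<gamma>\<close> to have (2,3) entry 0. With
  \<open>b\<close> normalised to 1, the nearby point of the curve has its parameter \<open>s\<close>
  as (2,3) entry; so \<open>s\<close> is small, that point and \<open>\<gamma>\<close> are close to
  the identity, and an integer matrix close enough to the identity equals it.\<close>

lemma not_recurrent_along:
  assumes A: "A \<in> sets M" "emeasure M A > 0"
    and wandering: "\<And>\<gamma>. \<gamma> \<in> H3Z \<Longrightarrow> \<gamma>$2$3 \<noteq> 0 \<Longrightarrow> emeasure M (A \<inter> T \<gamma> ` A) = 0"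
    and "b \<noteq> 0"
  shows "\<not> recurrent_along d M T (span {lie a b c})"
proof
  assume rec: "recurrent_along d M T (span {lie a b c})"
  define p q where "p = a / b" and "q = c / b"
  have span_eq: "span {lie a b c} = span {lie p 1 q}"
    using span_singleton_scale[of b "lie p 1 q"] \<open>b \<noteq> 0\<close> by (simp add: scaleR_lie p_def q_def)
  \<comment> \<open>Solves \<open>\<delta> * (1 + |p| + |q|) = 1\<close>, which keeps the integers
    \<open>x\<close> and \<open>z\<close> below 1 in absolute value.\<close>
  define \<delta> where "\<delta> = 1 / (1 + \<bar>p\<bar> + \<bar>q\<bar>)"
  have \<delta>: "\<delta> > 0" "\<delta> \<le> 1" "\<delta> + \<delta> * \<bar>p\<bar> + \<delta> * \<bar>q\<bar> = 1"
    using add_pos_nonneg[of 1 "\<bar>p\<bar> + \<bar>q\<bar>"] unfolding \<delta>_def by (auto simp: add_divide_distrib[symmetric])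
  obtain \<epsilon> where \<epsilon>: "\<epsilon> > 0"
    "\<And>a b c. d (heis a b c) (mat 1) < \<epsilon> \<Longrightarrow> \<bar>a\<bar> < \<delta> \<and> \<bar>b\<bar> < \<delta> \<and> \<bar>c\<bar> < \<delta>"
    using small_entries[OF \<delta>(1)] by blast
  obtain \<gamma> g where \<gamma>: "\<gamma> \<in> H3Z" "\<gamma> \<noteq> mat 1" "g \<in> mexp ` span {lie p 1 q}" "d \<gamma> g < \<epsilon>"
    "emeasure M (A \<inter> T \<gamma> ` A) > 0"
    using rec \<epsilon>(1) A unfolding recurrent_along_def span_eq by (metis DiffE insertI1)
  obtain x y z :: int where xyz: "\<gamma> = heis (of_int x) (of_int y) (of_int z)"
    using \<gamma>(1) H3Z_E by blast
  obtain s where s: "g = heis (s * p) s (s * q + s\<^sup>2 * p / 2)"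
    using \<gamma>(3) unfolding mexp_image_span by auto
  have y: "y = 0" using wandering[OF \<gamma>(1)] \<gamma>(5) xyz by (cases "y = 0") auto
  have small: "\<bar>of_int x - s * p\<bar> < \<delta>" "\<bar>s\<bar> < \<delta>"
    "\<bar>of_int z - (s * q + s\<^sup>2 * p / 2) - (of_int x - s * p) * s\<bar> < \<delta>"
    using \<epsilon>(2)[OF \<gamma>(4)[unfolded xyz s dist_heis]] y by auto
  have sp: "\<bar>s * p\<bar> \<le> \<delta> * \<bar>p\<bar>" and sq: "\<bar>s * q\<bar> \<le> \<delta> * \<bar>q\<bar>"
    using small(2) by (auto simp: abs_mult intro!: mult_right_mono)
  have "\<bar>of_int x :: real\<bar> < 1" 
    using small(1) sp \<delta> by (smt (verit) mult_nonneg_nonneg abs_ge_zero)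
  then have x: "x = 0" by linarith
  have "\<bar>s\<^sup>2 * p\<bar> = \<bar>s\<bar> * \<bar>s * p\<bar>" by (simp add: power2_eq_square abs_mult)
  also have "\<dots> \<le> 1 * (\<delta> * \<bar>p\<bar>)"
    using small(2) \<delta> sp by (intro mult_mono) auto
  finally have "\<bar>s\<^sup>2 * p\<bar> \<le> \<delta> * \<bar>p\<bar>" by simp
  \<comment> \<open>For \<open>x = 0\<close> the correction term of \<open>dist_heis\<close>
    contributes \<open>s\<^sup>2 * p\<close> and flips the sign of the quadratic term.\<close>
  moreover have "of_int z - (s * q + s\<^sup>2 * p / 2) - (of_int x - s * p) * s = of_int z - s * q + s\<^sup>2 * p / 2"
    using x by (simp add: power2_eq_square algebra_simps)
  ultimately have "\<bar>of_int z :: real\<bar> < 1"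
    using small(3) sq \<delta> by (smt (verit) mult_nonneg_nonneg abs_ge_zero field_sum_of_halves)
  then have "z = 0" by linarith
  then show False using x y xyz \<gamma>(2) by simp
qed

lemma rigid_imp_recurrent:
  assumes "rigid_along d M T \<theta>" "sigma_finite_measure M" "\<theta> \<in> P_h3R"
    and T: "\<And>\<gamma> A. \<gamma> \<in> H3Z \<Longrightarrow> A \<in> sets M \<Longrightarrow> T \<gamma> ` A \<in> sets M"
  shows "recurrent_along d M T \<theta>"
  unfolding recurrent_along_def
proof (intro allI impI ballI)
  fix \<epsilon> :: real and A assume \<epsilon>: "\<epsilon> > 0" and A: "A \<in> sets M" "emeasure M A > 0"
  interpret sigma_finite_measure M by fact
  \<comment> \<open>Rigidity controls sets of finite measure only, whereas recurrence tests every
    set of positive measure; sigma-finiteness supplies a finite piece.\<close>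
  obtain B where B: "B \<in> sets M" "B \<subseteq> A" "emeasure M B < \<infinity>" "emeasure M B > 0"
  proof (cases "emeasure M A = \<infinity>")
    case True
    show ?thesis
      by (rule approx_PInf_emeasure_with_finite[OF A(1) True, of 0]) (use that in auto)
  next
    case False
    then show ?thesis using that[of A] A by (auto simp: less_top)
  qed
  obtain s where s: "\<And>n. s n \<in> H3Z" "filterlim s cofinite sequentially"
     "(\<lambda>n. INF g\<in>mexp ` \<theta>. d (s n) g) \<longlonglongrightarrow> 0"
     "(\<lambda>n. emeasure M (B \<inter> T (s n) ` B)) \<longlonglongrightarrow> emeasure M B"
    using assms(1) B unfolding rigid_along_def by blast
  have "\<forall>\<^sub>F n in sequentially. s n \<noteq> mat 1"
    using s(2) unfolding filterlim_cofinite_iff by blast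
  moreover have "\<forall>\<^sub>F n in sequentially. (INF g\<in>mexp ` \<theta>. d (s n) g) < \<epsilon>"
    using order_tendstoD(2)[OF s(3) \<epsilon>] .
  moreover have "\<forall>\<^sub>F n in sequentially. emeasure M (B \<inter> T (s n) ` B) > 0"
    using order_tendstoD(1)[OF s(4) B(4)] .
  ultimately have "\<forall>\<^sub>F n in sequentially. s n \<noteq> mat 1 \<and> (INF g\<in>mexp ` \<theta>. d (s n) g) < \<epsilon>
      \<and> emeasure M (B \<inter> T (s n) ` B) > 0"
    by eventually_elim simp
  then obtain n where n: "s n \<noteq> mat 1" "(INF g\<in>mexp ` \<theta>. d (s n) g) < \<epsilon>"
      "emeasure M (B \<inter> T (s n) ` B) > 0"
    using eventually_happens'[OF sequentially_bot] by blast
  \<comment> \<open>An infimum over a nonempty set that lies below \<open>\<epsilon>\<close> yields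
    an actual \<open>g\<close>; over the empty set it would carry no information.\<close>
  have "\<theta> \<noteq> {}" using assms(3) subspace_0 by (auto simp: P_h3R_def)
  then obtain g where g: "g \<in> mexp ` \<theta>" "d (s n) g < \<epsilon>"
    using n(2) cInf_lessD[of "(\<lambda>g. d (s n) g) ` mexp ` \<theta>" \<epsilon>] by auto
  have "emeasure M (B \<inter> T (s n) ` B) \<le> emeasure M (A \<inter> T (s n) ` A)"
    using A B T s(1) by (intro emeasure_mono) auto
  then show "\<exists>\<gamma>\<in>H3Z - {mat 1}. \<exists>g\<in>mexp ` \<theta>. d \<gamma> g < \<epsilon> \<and> emeasure M (A \<inter> T \<gamma> ` A) > 0"
    using n s(1) g by (intro bexI[of _ "s n"] bexI[of _ g]) auto
qed

text \<open>For each \<open>n\<close> a nonzero point of \<open>(h n \<int>)\<^sup>2\<close> is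
  chosen near the line: the (1,2) entry is met exactly, and the corner up to
  \<open>1 / Suc n\<close>. Since nonzero multiples of \<open>h n\<close> have size at least
  \<open>h n\<close>, the sequence leaves every finite set.\<close>

lemma rigid_along_horizontal:
  assumes \<theta>: "\<theta> \<in> range theta \<union> {theta_infinity}"
    and h: "\<And>n. h n > (0::int)" "\<And>N. \<forall>\<^sub>F n in sequentially. h n > N"
    and T: "\<And>a c A. \<lbrakk>\<And>n. h n dvd a n \<and> h n dvd c n; A \<in> sets M; emeasure M A < \<infinity>\<rbrakk> \<Longrightarrow>
      (\<lambda>n. emeasure M (A \<inter> T (heis (of_int (a n)) 0 (of_int (c n))) ` A)) \<longlonglongrightarrow> emeasure M A"
  shows "rigid_along d M T \<theta>"
proof -
  obtain p r where pr: "\<theta> = span {lie p 0 r}" "p \<noteq> 0 \<or> r \<noteq> 0"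
    using \<theta> horizontal_iff[of \<theta>] by auto
  have "\<exists>a c x. (a \<noteq> 0 \<or> c \<noteq> 0) \<and> h n dvd a \<and> h n dvd c \<and> of_int a = x * p \<and> \<bar>of_int c - x * r\<bar> < 1 / Suc n" for n
  proof (cases "p = 0")
    case True
    \<comment> \<open>The central line contains lattice points exactly: \<open>x\<close> solves
      \<open>x * r = h n\<close>.\<close>
    then show ?thesis using pr(2) h(1)[of n]
      by (intro exI[of _ 0] exI[of _ "h n"] exI[of _ "of_int (h n) / r"]) auto
  next
    case False
    obtain a c where "a \<noteq> 0" "h n dvd a" "h n dvd c" "\<bar>of_int c - (r / p) * of_int a\<bar> < 1 / Suc n"
      by (rule Dirichlet_approx_dvd[of "1 / Suc n" "h n" "r / p"]) (simp_all add: h(1))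
    then show ?thesis using False
      by (intro exI[of _ a] exI[of _ c] exI[of _ "of_int a / p"]) (auto simp: mult.commute)
  qed
  then obtain a c x where nz: "\<And>n. a n \<noteq> 0 \<or> c n \<noteq> 0" and dvd: "\<And>n. h n dvd a n \<and> h n dvd c n"
    and ax: "\<And>n. of_int (a n) = x n * p" and cx: "\<And>n. \<bar>of_int (c n) - x n * r\<bar> < 1 / Suc n"
    by metis
  define s where "s n = heis (of_int (a n)) 0 (of_int (c n))" for n
  have "\<forall>\<^sub>F n in sequentially. s n \<noteq> \<gamma>" for \<gamma>
  proof -
    have "\<forall>\<^sub>F n in sequentially. h n > max \<lfloor>\<bar>\<gamma>$1$2\<bar>\<rfloor> \<lfloor>\<bar>\<gamma>$1$3\<bar>\<rfloor>" by (rule h)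
    then show ?thesis
    proof eventually_elim
      case (elim n)
      have "\<bar>a n\<bar> \<ge> h n \<or> \<bar>c n\<bar> \<ge> h n"
        using nz[of n] dvd[of n] dvd_imp_le_int[of "a n" "h n"] dvd_imp_le_int[of "c n" "h n"] h(1)[of n]
        by auto
      then show ?case using elim by (auto simp: s_def simp flip: of_int_abs)
    qed
  qed
  then have cofin: "filterlim s cofinite sequentially"
    unfolding filterlim_cofinite_iff by blast
  have mexp: "heis (x n * p) 0 (x n * r) \<in> mexp ` \<theta>" for n
    unfolding pr(1) mexp_image_span by auto
  have bdd: "bdd_below ((\<lambda>g. d (s n) g) ` mexp ` \<theta>)" for n
    by (rule bdd_belowI[of _ 0]) auto
  have "(\<lambda>n. INF g\<in>mexp ` \<theta>. d (s n) g) \<longlonglongrightarrow> 0"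
  proof (rule order_tendstoI)
    fix e :: real assume "e < 0"
    moreover have "0 \<le> (INF g\<in>mexp ` \<theta>. d (s n) g)" for n
      using mexp by (intro cINF_greatest) auto
    ultimately show "\<forall>\<^sub>F n in sequentially. e < (INF g\<in>mexp ` \<theta>. d (s n) g)"
      by (intro always_eventually allI) (meson less_le_trans)
  next
    fix e :: real assume "0 < e"
    then obtain \<delta> where \<delta>: "\<delta> > 0"
      "\<And>a b c. \<bar>a\<bar> < \<delta> \<Longrightarrow> \<bar>b\<bar> < \<delta> \<Longrightarrow> \<bar>c\<bar> < \<delta> \<Longrightarrow> d (heis a b c) (mat 1) < e"
      using small_dist by blast
    have "\<forall>\<^sub>F n in sequentially. 1 / Suc n < \<delta>"
      using order_tendstoD(2)[OF LIMSEQ_Suc[OF lim_inverse_n'] \<delta>(1)] by simp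
    then show "\<forall>\<^sub>F n in sequentially. (INF g\<in>mexp ` \<theta>. d (s n) g) < e"
    proof eventually_elim
      case (elim n)
      have "(INF g\<in>mexp ` \<theta>. d (s n) g) \<le> d (s n) (heis (x n * p) 0 (x n * r))"
        using bdd mexp by (intro cINF_lower) auto
      also have "\<dots> < e"
        unfolding s_def dist_heis using cx[of n] elim \<delta>(1) by (intro \<delta>(2)) (auto simp: ax)
      finally show ?case .
    qed
  qed
  then show ?thesis
    unfolding rigid_along_def
    using cofin T[OF dvd] by (intro exI[of _ s]) (auto simp: s_def)
qed

text \<open>The four sets are squeezed: rigidity holds on all horizontal lines, it implies
  recurrence, and recurrence forces a line to be horizontal. Orbits of horizontal lines stay
  horizontal and every line lies in its own orbit, which settles the even versions.\<close>

lemma directional_sets_eq_horizontal: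
  assumes A: "A \<in> sets M" "emeasure M A > 0"
      "\<And>\<gamma>. \<gamma> \<in> H3Z \<Longrightarrow> \<gamma>$2$3 \<noteq> 0 \<Longrightarrow> emeasure M (A \<inter> T \<gamma> ` A) = 0"
    and M: "sigma_finite_measure M"
    and T: "\<And>\<gamma> A. \<gamma> \<in> H3Z \<Longrightarrow> A \<in> sets M \<Longrightarrow> T \<gamma> ` A \<in> sets M"
    and rigid: "\<And>\<theta>. \<theta> \<in> range theta \<union> {theta_infinity} \<Longrightarrow> rigid_along d M T \<theta>"
  shows "Rec d M T = range theta \<union> {theta_infinity}" "Rig d M T = range theta \<union> {theta_infinity}"
    "Even_Rec d M T = range theta \<union> {theta_infinity}" "Even_Rig d M T = range theta \<union> {theta_infinity}"
proof -
  have P: "\<theta> \<in> P_h3R" if "\<theta> \<in> range theta \<union> {theta_infinity}" for \<theta>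
    using that horizontal_iff span_lie_in_P_h3R by metis
  have rec: "\<theta> \<in> range theta \<union> {theta_infinity}" if "\<theta> \<in> P_h3R" "recurrent_along d M T \<theta>" for \<theta>
  proof -
    obtain a b c where abc: "\<theta> = span {lie a b c}" "lie a b c \<noteq> 0"
      using \<open>\<theta> \<in> P_h3R\<close> P_h3R_E by blast
    have "b = 0"
    proof (rule ccontr)
      assume "b \<noteq> 0"
      from not_recurrent_along[OF A this] show False using abc(1) that(2) by simp
    qed
    then show ?thesis using abc horizontal_iff by blast
  qed
  have rig: "recurrent_along d M T \<theta>" if "rigid_along d M T \<theta>" "\<theta> \<in> P_h3R" for \<theta>
    using rigid_imp_recurrent[OF that(1) M that(2) T] by blast
  let ?S = "range theta \<union> {theta_infinity}"
  have orbit: "\<theta>' \<in> ?S" if "\<theta> \<in> ?S" "\<theta>' \<in> line_orbit \<theta>" for \<theta> \<theta>'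
    using line_orbit_horizontal that .
  show "Rec d M T = ?S"
  proof (intro equalityI subsetI)
    fix \<theta> assume "\<theta> \<in> Rec d M T"
    then show "\<theta> \<in> ?S" unfolding Rec_def by (elim CollectE conjE) (rule rec)
  next
    fix \<theta> assume "\<theta> \<in> ?S"
    then show "\<theta> \<in> Rec d M T" using P[of \<theta>] rig[OF rigid[of \<theta>] P[of \<theta>]] unfolding Rec_def by simp
  qed
  show "Rig d M T = ?S"
  proof (intro equalityI subsetI)
    fix \<theta> assume "\<theta> \<in> Rig d M T"
    then have "\<theta> \<in> P_h3R" "rigid_along d M T \<theta>" unfolding Rig_def by auto
    from rec[OF this(1) rig[OF this(2,1)]] show "\<theta> \<in> ?S" .
  next
    fix \<theta> assume "\<theta> \<in> ?S"
    then show "\<theta> \<in> Rig d M T" using P[of \<theta>] rigid[of \<theta>] unfolding Rig_def by simp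
  qed
  show "Even_Rec d M T = ?S"
  proof (intro equalityI subsetI)
    fix \<theta> assume "\<theta> \<in> Even_Rec d M T"
    then have "\<theta> \<in> P_h3R" "recurrent_along d M T \<theta>"
      using self_in_line_orbit unfolding Even_Rec_def by blast+
    then show "\<theta> \<in> ?S" by (rule rec)
  next
    fix \<theta> assume "\<theta> \<in> ?S"
    then show "\<theta> \<in> Even_Rec d M T"
      unfolding Even_Rec_def using P rig[OF rigid[OF orbit] P[OF orbit]] by simp
  qed
  show "Even_Rig d M T = ?S"
  proof (intro equalityI subsetI)
    fix \<theta> assume "\<theta> \<in> Even_Rig d M T"
    then have "\<theta> \<in> P_h3R" "rigid_along d M T \<theta>"
      using self_in_line_orbit unfolding Even_Rig_def by blast+
    from rec[OF this(1) rig[OF this(2,1)]] show "\<theta> \<in> ?S" .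
  next
    fix \<theta> assume "\<theta> \<in> ?S"
    then show "\<theta> \<in> Even_Rig d M T"
      unfolding Even_Rig_def using P rigid[OF orbit] by simp
  qed
qed

end

section \<open>Measure-theoretic and arithmetic preliminaries\<close>

text \<open>The approximable sets form a sigma-algebra. For a countable union, finiteness of the
  measure makes the remainder beyond some \<open>N\<close> small, and the finitely many other sets
  share the second half of the error.\<close>

lemma (in finite_measure) approx_by_generating_algebra:
  assumes alg: "algebra (space M) G" and gen: "sets M = sigma_sets (space M) G"
    and A: "A \<in> sets M" and "\<epsilon> > 0"
  shows "\<exists>L\<in>G. measure M (sym_diff A L) < \<epsilon>"
  using A[unfolded gen] \<open>\<epsilon> > 0\<close>
proof (induction arbitrary: \<epsilon> rule: sigma_sets.induct)
  interpret algebra "space M" G by fact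
  {
    case (Basic A)
    then show ?case by (intro bexI[of _ A]) auto
  next
    case Empty
    then show ?case by (intro bexI[of _ "{}"]) auto
  next
    case (Compl A)
    then obtain L where L: "L \<in> G" "measure M (sym_diff A L) < \<epsilon>" by blast
    have "A \<subseteq> space M" "L \<subseteq> space M"
      using Compl.hyps L(1) gen sets.sets_into_space space_closed by auto
    then have "sym_diff (space M - A) (space M - L) = sym_diff A L" by auto
    then show ?case using L by (intro bexI[of _ "space M - L"]) auto
  next
    case (Union A)
    have sets_A [measurable]: "A i \<in> sets M" for i using Union.hyps gen by simp
    let ?D = "\<lambda>N. (\<Union>i. A i) - (\<Union>i<N. A i)"
    have "(\<lambda>N. measure M (?D N)) \<longlonglongrightarrow> measure M (\<Inter>N. ?D N)"
      by (rule finite_Lim_measure_decseq) (auto simp: decseq_def)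
    moreover have "(\<Inter>N. ?D N) = {}" by auto
    ultimately have "(\<lambda>N. measure M (?D N)) \<longlonglongrightarrow> 0" by (simp only: measure_empty)
    then have "\<forall>\<^sub>F N in sequentially. measure M (?D N) < \<epsilon> / 2"
      using Union.prems by (intro order_tendstoD(2)) auto
    then obtain N where N: "measure M (?D N) < \<epsilon> / 2"
      using eventually_happens'[OF sequentially_bot] by blast
    \<comment> \<open>\<open>N + 1\<close> instead of \<open>N\<close> keeps the bound positive when
      \<open>N = 0\<close>.\<close>
    have "\<forall>i. \<exists>L\<in>G. measure M (sym_diff (A i) L) < \<epsilon> / (2 * (N + 1))"
      using Union.IH Union.prems by simp
    then obtain L where L: "\<And>i. L i \<in> G" "\<And>i. measure M (sym_diff (A i) (L i)) < \<epsilon> / (2 * (N + 1))"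
      by metis
    have sets_L [measurable]: "L i \<in> sets M" for i using L(1) gen by auto
    have "measure M (sym_diff (\<Union>i. A i) (\<Union>i<N. L i))
        \<le> measure M (?D N \<union> (\<Union>i<N. sym_diff (A i) (L i)))"
      by (intro finite_measure_mono) auto
    also have "\<dots> \<le> measure M (?D N) + measure M (\<Union>i<N. sym_diff (A i) (L i))"
      by (intro measure_Un_le) auto
    also have "measure M (\<Union>i<N. sym_diff (A i) (L i)) \<le> (\<Sum>i<N. measure M (sym_diff (A i) (L i)))"
      by (intro measure_UNION_le) auto
    also have "\<dots> \<le> (\<Sum>i<N. \<epsilon> / (2 * (N + 1)))"
      by (intro sum_mono less_imp_le L)
    also have "\<dots> \<le> \<epsilon> / 2"
      using Union.prems by (simp add: field_simps)
    finally have "measure M (sym_diff (\<Union>i. A i) (\<Union>i<N. L i)) < \<epsilon>" using N by simp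
    moreover have "(\<Union>i<N. L i) \<in> G" using L(1) by (intro finite_UN) auto
    ultimately show ?case by blast
  }
qed

text \<open>A product measure is determined by boxes with finitely many constraints, and the
  preimage of such a box under a coordinatewise map is again one.\<close>

lemma PiM_coordinatewise_preserving:
  assumes M: "\<And>i. prob_space (M i)"
    and f: "\<And>i. f i \<in> measurable (M i) (M i)" "\<And>i. distr (M i) (M i) (f i) = M i"
  shows "distr (PiM UNIV M) (PiM UNIV M) (\<lambda>y i. f i (y i)) = PiM UNIV M"
proof -
  interpret M: prob_space "M i" for i by (rule M)
  interpret product_prob_space M UNIV by unfold_locales
  have meas: "(\<lambda>y i. f i (y i)) \<in> measurable (PiM UNIV M) (PiM UNIV M)"
  proof (rule measurable_PiM_single')
    show "(\<lambda>y. f i (y i)) \<in> measurable (PiM UNIV M) (M i)" for i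
      by (rule measurable_compose[OF _ f(1)[of i]], rule measurable_component_singleton) simp
  next
    show "(\<lambda>y i. f i (y i)) \<in> space (PiM UNIV M) \<rightarrow> (\<Pi>\<^sub>E i\<in>UNIV. space (M i))"
      using measurable_space[OF f(1)] by (auto simp: space_PiM PiE_iff)
  qed
  show ?thesis
  proof (rule PiM_eq)
    fix J F assume J: "finite J" and F: "\<And>j. j \<in> J \<Longrightarrow> F j \<in> sets (M j)"
    let ?F = "\<lambda>j. f j -` F j \<inter> space (M j)"
    have "emeasure (distr (PiM UNIV M) (PiM UNIV M) (\<lambda>y i. f i (y i))) (emb UNIV J (Pi\<^sub>E J F))
        = emeasure (PiM UNIV M) ((\<lambda>y i. f i (y i)) -` emb UNIV J (Pi\<^sub>E J F) \<inter> space (PiM UNIV M))"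
      using J F by (intro emeasure_distr meas sets_PiM_I) auto
    also have "(\<lambda>y i. f i (y i)) -` emb UNIV J (Pi\<^sub>E J F) \<inter> space (PiM UNIV M) = emb UNIV J (Pi\<^sub>E J ?F)"
      using measurable_space[OF f(1)] by (auto simp: prod_emb_def space_PiM PiE_iff)
    also have "emeasure (PiM UNIV M) \<dots> = (\<Prod>j\<in>J. emeasure (M j) (?F j))"
      using J F f(1) by (intro emeasure_PiM_emb) (auto intro: measurable_sets)
    also have "\<dots> = (\<Prod>j\<in>J. emeasure (M j) (F j))"
      using F by (intro prod.cong refl) (metis emeasure_distr f)
    finally show "emeasure (distr (PiM UNIV M) (PiM UNIV M) (\<lambda>y i. f i (y i))) (emb UNIV J (Pi\<^sub>E J F))
        = (\<Prod>j\<in>J. emeasure (M j) (F j))" .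
  qed simp
qed

definition residue_square :: "int \<Rightarrow> (int \<times> int) set" where
  "residue_square k = {0..<k} \<times> {0..<k}"

text \<open>The value outside the square makes \<open>shift\<close> an action on the whole type; the measure below does not
  charge the points concerned.\<close>

definition shift :: "int \<Rightarrow> int \<times> int \<Rightarrow> int \<times> int \<Rightarrow> int \<times> int" where
  "shift k v p =
     (if p \<in> residue_square k then ((fst p + fst v) mod k, (snd p + snd v) mod k) else p)"

lemma finite_residue_square [simp]: "finite (residue_square k)"
  by (simp add: residue_square_def)

lemma shift_in_residue_square_iff:
  "k > 0 \<Longrightarrow> shift k v p \<in> residue_square k \<longleftrightarrow> p \<in> residue_square k"
  by (simp add: shift_def residue_square_def)

lemma shift_dvd: "k dvd fst v \<Longrightarrow> k dvd snd v \<Longrightarrow> shift k v p = p"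
  by (cases p) (auto simp: shift_def residue_square_def mod_add_right_eq[symmetric] dvd_imp_mod_0 simp del: mod_add_right_eq)

lemma shift_0 [simp]: "shift k (0, 0) p = p"
  by (simp add: shift_dvd)

lemma shift_shift:
  "k > 0 \<Longrightarrow> shift k v (shift k w p) = shift k (fst v + fst w, snd v + snd w) p"
  by (cases "p \<in> residue_square k")
    (simp_all add: shift_def residue_square_def mod_simps algebra_simps)

lemma shift_eq_self_iff:
  assumes "p \<in> residue_square k"
  shows "shift k v p = p \<longleftrightarrow> k dvd fst v \<and> k dvd snd v"
proof -
  have "(x + a) mod k = x \<longleftrightarrow> k dvd a" if "0 \<le> x" "x < k" for x a :: int
    using that mod_eq_dvd_iff[of "x + a" k x] by simp
  then show ?thesis using assms by (cases p) (auto simp: shift_def residue_square_def)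
qed

lemma bij_betw_shift:
  assumes "k > 0" shows "bij_betw (shift k v) (residue_square k) (residue_square k)"
proof (rule bij_betw_byWitness[where f' = "shift k (- fst v, - snd v)"])
qed (use assms in \<open>auto simp: shift_shift shift_in_residue_square_iff\<close>)

section \<open>The odometer and the induced action\<close>

locale coprime_moduli =
  fixes m :: "nat \<Rightarrow> int"
  assumes m_gt_1: "m i > 1" and coprime_m: "i \<noteq> j \<Longrightarrow> coprime (m i) (m j)"
begin

lemma m_pos: "m i > 0" using m_gt_1[of i] by simp

definition h :: "nat \<Rightarrow> int" where "h n = (\<Prod>i<n. m i)"

lemma h_Suc: "h (Suc n) = h n * m n" by (simp add: h_def)

lemma coprime_h: "coprime (h n) (m n)"
  unfolding h_def by (intro prod_coprime_left coprime_m) auto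

text \<open>Links two languages: divisibility by \<open>h n\<close> is what the rigid times satisfy,
  divisibility by each \<open>m i\<close> is what makes the first \<open>n\<close> coordinates stand
  still. It rests on coprimality.\<close>

lemma h_dvd_iff: "h n dvd a \<longleftrightarrow> (\<forall>i<n. m i dvd a)"
proof (induction n)
  case (Suc n)
  have "h (Suc n) dvd a \<longleftrightarrow> h n dvd a \<and> m n dvd a"
    unfolding h_Suc using coprime_h[of n] by (metis divides_mult dvd_mult_left dvd_mult_right)
  then show ?case using Suc by (auto simp: less_Suc_eq)
qed (simp add: h_def)

lemma h_ge: "h n \<ge> 2 ^ n"
proof (induction n)
  case (Suc n)
  have "2 ^ n * 2 \<le> h n * m n" using Suc m_gt_1[of n]
    by (intro mult_mono order_trans[OF _ Suc]) auto
  then show ?case by (simp add: h_Suc)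
qed (simp add: h_def)

lemma h_pos: "h n > 0" using h_ge[of n] by (smt (verit) zero_less_power)

lemma h_gt: "h n > int n"
  using h_ge[of n] of_nat_less_two_power[of n, where 'a = int] by linarith

text \<open>One modulus is added at a time. Existence will make the levels of a tower cover its
  fibres up to a null set; uniqueness, proved next, will make them disjoint.\<close>

lemma chinese_remainder_h: "\<exists>x\<in>{0..<h n}. \<forall>i<n. x mod m i = r i mod m i"
proof -
  have "\<exists>x. \<forall>i<n. x mod m i = r i mod m i"
  proof (induction n)
    case (Suc n)
    then obtain x where x: "\<And>i. i < n \<Longrightarrow> x mod m i = r i mod m i" by blast
    obtain z where z: "[z = x] (mod h n)" "[z = r n] (mod m n)"
      using binary_chinese_remainder_int[OF coprime_h] by blast
    have "m i dvd z - x" if "i < n" for i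
      using z(1) h_dvd_iff[of n "z - x"] that by (simp add: cong_iff_dvd_diff)
    then have "z mod m i = r i mod m i" if "i < n" for i
      using that x[OF that] by (metis mod_eq_dvd_iff)
    then show ?case using z(2) by (intro exI[of _ z]) (auto simp: less_Suc_eq cong_def)
  qed simp
  then obtain x where x: "\<And>i. i < n \<Longrightarrow> x mod m i = r i mod m i" by blast
  have "x mod h n mod m i = x mod m i" if "i < n" for i
    using that h_dvd_iff[of n "h n"] by (intro mod_mod_cancel) simp
  then show ?thesis using x h_pos[of n] by (intro bexI[of _ "x mod h n"]) auto
qed

lemma chinese_remainder_h_unique:
  assumes "a \<in> {0..<h n}" "a' \<in> {0..<h n}" "\<And>i. i < n \<Longrightarrow> a mod m i = a' mod m i"
  shows "a = a'"
proof -
  have "h n dvd a - a'" using assms(3) by (simp add: h_dvd_iff mod_eq_dvd_iff)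
  then have "a mod h n = a' mod h n" by (simp add: mod_eq_dvd_iff)
  then show ?thesis using assms by simp
qed

text \<open>On sequences of residues this is the odometer on the inverse limit of the groups of
  residue pairs modulo \<open>h n\<close>, in Chinese remainder coordinates, where no carries
  occur.\<close>

definition translate :: "int \<times> int \<Rightarrow> (nat \<Rightarrow> int \<times> int) \<Rightarrow> nat \<Rightarrow> int \<times> int" where
  "translate v y = (\<lambda>i. shift (m i) v (y i))"

definition residue_pmf :: "nat \<Rightarrow> (int \<times> int) pmf" where
  "residue_pmf i = pmf_of_set (residue_square (m i))"

text \<open>Haar measure of the product of the finite groups, but living on all sequences: with
  \<open>measure_pmf\<close> factors the space is the whole type, and the sequences with a
  coordinate outside its square form a null set.\<close>

definition odometer :: "(nat \<Rightarrow> int \<times> int) measure" where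
  "odometer = PiM UNIV (\<lambda>i. measure_pmf (residue_pmf i))"

lemma residue_square_ne: "residue_square (m i) \<noteq> {}"
  using m_pos[of i] by (auto simp: residue_square_def)

lemma set_residue_pmf: "set_pmf (residue_pmf i) = residue_square (m i)"
  by (simp add: residue_pmf_def residue_square_ne)

lemma map_pmf_shift: "map_pmf (shift (m i) v) (residue_pmf i) = residue_pmf i"
  unfolding residue_pmf_def
  by (intro map_pmf_of_set_bij_betw bij_betw_shift m_pos residue_square_ne) simp

lemma product_prob_space_residue: "product_prob_space (\<lambda>i. measure_pmf (residue_pmf i))"
proof -
  interpret prob_space "measure_pmf (residue_pmf i)" for i by (rule prob_space_measure_pmf)
  show ?thesis by unfold_locales
qed

lemma prob_space_odometer: "prob_space odometer"
  unfolding odometer_def by (intro prob_space_PiM prob_space_measure_pmf)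

lemma space_odometer [simp]: "space odometer = UNIV"
  by (simp add: odometer_def space_PiM)

lemma distr_translate: "distr odometer odometer (translate v) = odometer"
  unfolding odometer_def translate_def
proof (rule PiM_coordinatewise_preserving)
  show "distr (measure_pmf (residue_pmf i)) (measure_pmf (residue_pmf i)) (shift (m i) v) = measure_pmf (residue_pmf i)" for i
  proof -
    have "distr (measure_pmf (residue_pmf i)) (measure_pmf (residue_pmf i)) (shift (m i) v)
      = distr (measure_pmf (residue_pmf i)) (count_space UNIV) (shift (m i) v)"
      by (intro distr_cong) auto
    also have "\<dots> = measure_pmf (residue_pmf i)"
      by (simp flip: map_pmf_rep_eq add: map_pmf_shift)
    finally show ?thesis .
  qed
qed (simp_all add: prob_space_measure_pmf)

lemma AE_odometer: "AE y in odometer. \<forall>i. y i \<in> residue_square (m i)"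
proof -
  interpret product_prob_space "\<lambda>i. measure_pmf (residue_pmf i)" UNIV
    by (rule product_prob_space_residue)
  show ?thesis
    unfolding odometer_def AE_all_countable
    using set_residue_pmf by (intro allI AE_component) (auto simp: AE_measure_pmf_iff)
qed

definition induced :: "((nat \<Rightarrow> int \<times> int) \<times> int) measure" where
  "induced = odometer \<Otimes>\<^sub>M count_space UNIV"

text \<open>With \<open>u = heis 0 1 0\<close> and \<open>(y, k)\<close> standing for \<open>u\<^sup>k y\<close>, the formula comes from
  \<open>heis a b c = u\<^sup>b ** heis a 0 c\<close> and \<open>heis a 0 c ** u\<^sup>k = u\<^sup>k ** heis a 0 (c + a * k)\<close>.\<close>

definition act :: "int \<Rightarrow> int \<Rightarrow> int \<Rightarrow> (nat \<Rightarrow> int \<times> int) \<times> int \<Rightarrow> (nat \<Rightarrow> int \<times> int) \<times> int" where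
  "act a b c = (\<lambda>(y, k). (translate (a, c + a * k) y, k + b))"

lemma space_induced [simp]: "space induced = UNIV"
  by (simp add: induced_def space_pair_measure)

lemma translate_translate: "translate v (translate w y) = translate (fst v + fst w, snd v + snd w) y"
  by (simp add: translate_def shift_shift m_pos)

lemma translate_0 [simp]: "translate (0, 0) y = y"
  by (simp add: translate_def)

lemma act_0 [simp]: "act 0 0 0 x = x"
  by (cases x) (simp add: act_def)

lemma act_act: "act a b c (act a' b' c' x) = act (a + a') (b + b') (c + c' + a * b') x"
  by (cases x) (simp add: act_def translate_translate algebra_simps)

text \<open>The entries of the inverse matrix give the inverse map. The notions of the theorem speak
  of images, measurability of preimages; this identity passes from one to the other.\<close>

lemma act_image: "act a b c ` A = act (- a) (- b) (a * b - c) -` A"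
proof
  show "act (- a) (- b) (a * b - c) -` A \<subseteq> act a b c ` A"
  proof
    fix x assume "x \<in> act (- a) (- b) (a * b - c) -` A"
    then show "x \<in> act a b c ` A"
      by (intro image_eqI[of _ _ "act (- a) (- b) (a * b - c) x"]) (auto simp: act_act)
  qed
qed (auto simp: act_act)

section \<open>Cylinder sets, approximation, rigidity and freeness\<close>

definition cyl :: "nat \<Rightarrow> ((nat \<Rightarrow> int \<times> int) \<times> int) set \<Rightarrow> bool" where
  "cyl n L \<longleftrightarrow> (\<forall>y y' k. (\<forall>i<n. y i = y' i) \<longrightarrow> ((y, k) \<in> L \<longleftrightarrow> (y', k) \<in> L))"

lemma cyl_mono: "cyl n L \<Longrightarrow> n \<le> n' \<Longrightarrow> cyl n' L"
  unfolding cyl_def by (meson less_le_trans)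

text \<open>Lists form a countable type, so arbitrary unions of cells are countable unions although
  the coordinates range over an infinite type. Cells serve twice: for the measurability of cylinders
  and as a base of the topology.\<close>

definition cell :: "(int \<times> int) list \<Rightarrow> int \<Rightarrow> ((nat \<Rightarrow> int \<times> int) \<times> int) set" where
  "cell l k = {y. \<forall>i\<in>{..<length l}. y i = l ! i} \<times> {k}"

lemma mem_cell_map: "(y, k) \<in> cell (map y [0..<n]) k"
  by (simp add: cell_def)

lemma cell_in_sets_induced: "cell l k \<in> sets induced"
proof -
  have "{y \<in> space odometer. \<forall>i\<in>{..<length l}. y i = l ! i} \<in> sets odometer"
    unfolding odometer_def by measurable
  then show ?thesis unfolding induced_def cell_def by (auto intro!: pair_measureI)
qed

lemma cyl_eq_Union_cells:
  assumes "cyl n L"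
  shows "L = (\<Union>(l, k)\<in>{(l, k). cell l k \<subseteq> L}. cell l k)"
proof (intro equalityI subsetI)
  fix x assume "x \<in> L"
  obtain y k where x: "x = (y, k)" by (cases x)
  have "cell (map y [0..<n]) k \<subseteq> L"
    using assms \<open>x \<in> L\<close> unfolding x by (auto simp: cell_def cyl_def)
  then show "x \<in> (\<Union>(l, k)\<in>{(l, k). cell l k \<subseteq> L}. cell l k)"
    unfolding x by (intro UN_I[of "(map y [0..<n], k)"]) (auto simp: mem_cell_map)
qed auto

lemma Union_cells_in_sets_induced: "(\<Union>(l, k)\<in>S. cell l k) \<in> sets induced"
  by (intro sets.countable_UN') (auto intro: cell_in_sets_induced)

lemma cyl_in_sets_induced: "cyl n L \<Longrightarrow> L \<in> sets induced"
  by (subst cyl_eq_Union_cells) (auto intro: Union_cells_in_sets_induced)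

lemma algebra_cyl: "algebra UNIV {L. \<exists>n. cyl n L}"
  unfolding algebra_iff_Un
proof (intro conjI ballI)
  fix a b assume "a \<in> {L. \<exists>n. cyl n L}" "b \<in> {L. \<exists>n. cyl n L}"
  then obtain n n' where "cyl n a" "cyl n' b" by auto
  then have "cyl (max n n') a" "cyl (max n n') b" by (auto intro: cyl_mono)
  then have "cyl (max n n') (a \<union> b)" unfolding cyl_def by blast
  then show "a \<union> b \<in> {L. \<exists>n. cyl n L}" by blast
qed (auto simp: cyl_def)

text \<open>A condition on coordinate \<open>i\<close> is a cylinder of length \<open>Suc i\<close>,
  so the projections are measurable for the right-hand side; conversely, cylinders are countable
  unions of cells.\<close>

lemma sets_induced_eq_sigma_cyl: "sets induced = sigma_sets UNIV {L. \<exists>n. cyl n L}"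
proof
  let ?N = "sigma UNIV {L. \<exists>n. cyl n L}"
  have N: "L \<in> sets ?N" if "cyl n L" for n L
    using that by (auto intro: in_measure_of)
  have fst: "fst \<in> measurable ?N odometer"
    unfolding odometer_def
  proof (rule measurable_PiM_single')
    fix i
    have "cyl (Suc i) ((\<lambda>x. fst x i) -` A)" for A by (auto simp: cyl_def)
    then show "(\<lambda>x. fst x i) \<in> measurable ?N (measure_pmf (residue_pmf i))"
      by (intro measurableI) (auto intro: N)
  qed auto
  have snd: "snd \<in> measurable ?N (count_space UNIV)"
  proof (rule measurableI)
    fix A :: "int set"
    have "cyl 0 (snd -` A)" by (auto simp: cyl_def)
    then show "snd -` A \<inter> space ?N \<in> sets ?N" by (auto intro: N)
  qed auto
  have "(\<lambda>x. (fst x, snd x)) \<in> measurable ?N induced"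
    unfolding induced_def using fst snd by (rule measurable_Pair)
  from measurable_sets[OF this] show "sets induced \<subseteq> sigma_sets UNIV {L. \<exists>n. cyl n L}"
    by (auto simp: vimage_def)
  show "sigma_sets UNIV {L. \<exists>n. cyl n L} \<subseteq> sets induced"
    using cyl_in_sets_induced sets.sigma_sets_subset[of "{L. \<exists>n. cyl n L}" induced] by auto
qed

lemma sigma_finite_induced: "sigma_finite_measure induced"
proof -
  interpret prob_space odometer by (rule prob_space_odometer)
  interpret C: sigma_finite_measure "count_space (UNIV :: int set)"
    by (rule sigma_finite_measure_count_space)
  interpret pair_sigma_finite odometer "count_space (UNIV :: int set)" ..
  show ?thesis unfolding induced_def by unfold_locales
qed

lemma emeasure_induced:
  assumes "A \<in> sets induced"
  shows "emeasure induced A = (\<integral>\<^sup>+k. emeasure odometer {y. (y, k) \<in> A} \<partial>count_space UNIV)"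
proof -
  interpret prob_space odometer by (rule prob_space_odometer)
  interpret C: sigma_finite_measure "count_space (UNIV :: int set)"
    by (rule sigma_finite_measure_count_space)
  interpret pair_sigma_finite odometer "count_space (UNIV :: int set)" ..
  show ?thesis
    using emeasure_pair_measure_alt2[of A] assms by (simp add: induced_def vimage_def)
qed

lemma emeasure_induced_Times:
  assumes "A \<in> sets odometer"
  shows "emeasure induced (A \<times> K) = emeasure odometer A * emeasure (count_space UNIV) K"
proof -
  interpret C: sigma_finite_measure "count_space (UNIV :: int set)"
    by (rule sigma_finite_measure_count_space)
  show ?thesis unfolding induced_def using assms by (intro C.emeasure_pair_measure_Times) auto
qed

lemma emeasure_induced_UNIV_Times: "emeasure induced (UNIV \<times> K) = emeasure (count_space UNIV) K"
proof -
  interpret prob_space odometer by (rule prob_space_odometer)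
  show ?thesis using emeasure_induced_Times[of UNIV K] emeasure_space_1 sets.top[of odometer] by simp
qed

lemma AE_induced: "AE x in induced. \<forall>i. fst x i \<in> residue_square (m i)"
proof -
  obtain N where N: "N \<in> null_sets odometer" "{y \<in> space odometer. \<not> (\<forall>i. y i \<in> residue_square (m i))} \<subseteq> N"
    using AE_odometer by (auto simp: eventually_ae_filter)
  have "N \<times> UNIV \<in> sets induced" using N(1) unfolding induced_def by (intro pair_measureI) auto
  then have "N \<times> UNIV \<in> null_sets induced"
    using N(1) emeasure_induced_Times[of N UNIV] null_setsD1[OF N(1)] null_setsD2[OF N(1)]
    by (intro null_setsI) auto
  then show ?thesis by (rule AE_I') (use N(2) in auto)
qed

lemma measurable_translate [measurable]: "translate v \<in> measurable odometer odometer"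
proof -
  have "(\<lambda>y. shift (m i) v (y i)) \<in> measurable odometer (measure_pmf (residue_pmf i))" for i
  proof -
    have "(\<lambda>y. y i) \<in> measurable odometer (measure_pmf (residue_pmf i))"
      unfolding odometer_def by (rule measurable_component_singleton) simp
    then show ?thesis by (rule measurable_compose) simp
  qed
  then show ?thesis
    unfolding translate_def by (subst (2) odometer_def) (intro measurable_PiM_single', auto)
qed

lemma measurable_act [measurable]: "act a b c \<in> measurable induced induced"
proof -
  have "(\<lambda>x. translate (a, c + a * snd x) (fst x)) \<in> measurable induced odometer"
  \<comment> \<open>The translation vector depends on the fibre; as there are countably many fibres,
    it may be frozen at a fixed \<open>k\<close>.\<close>
  proof (rule measurable_compose_countable[where f = "\<lambda>k x. translate (a, c + a * k) (fst x)" and g = snd])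
    show "(\<lambda>x. translate (a, c + a * k) (fst x)) \<in> measurable induced odometer" for k
      unfolding induced_def by measurable
    show "snd \<in> measurable induced (count_space UNIV)" unfolding induced_def by measurable
  qed
  moreover have "(\<lambda>x. snd x + b) \<in> measurable induced (count_space UNIV)"
    unfolding induced_def by measurable
  ultimately have "(\<lambda>x. (translate (a, c + a * snd x) (fst x), snd x + b)) \<in> measurable induced (odometer \<Otimes>\<^sub>M count_space UNIV)"
    by (rule measurable_Pair)
  then show ?thesis by (simp add: act_def induced_def case_prod_beta')
qed

text \<open>Fibre \<open>k\<close> undergoes a translation, which preserves the odometer, and is
  carried to fibre \<open>k + b\<close>; this permutation leaves the sum over the fibres
  unchanged.\<close>

lemma emeasure_induced_vimage_act:
  assumes A: "A \<in> sets induced"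
  shows "emeasure induced (act a b c -` A) = emeasure induced A"
proof -
  have sect: "{y. (y, k) \<in> A} \<in> sets odometer" for k
    using sets_Pair2[of A odometer "count_space UNIV" k] A by (simp add: induced_def vimage_def)
  have "act a b c -` A \<in> sets induced" using measurable_sets[OF measurable_act A] by simp
  then have "emeasure induced (act a b c -` A)
      = (\<integral>\<^sup>+k. emeasure odometer {y. (y, k) \<in> act a b c -` A} \<partial>count_space UNIV)"
    by (rule emeasure_induced)
  also have "\<dots> = (\<integral>\<^sup>+k. emeasure odometer {y. (y, k + b) \<in> A} \<partial>count_space UNIV)"
  proof (intro nn_integral_cong)
    fix k
    have "emeasure odometer {y. (y, k) \<in> act a b c -` A}
        = emeasure odometer (translate (a, c + a * k) -` {y. (y, k + b) \<in> A} \<inter> space odometer)"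
      by (simp add: act_def vimage_def)
    also have "\<dots> = emeasure (distr odometer odometer (translate (a, c + a * k))) {y. (y, k + b) \<in> A}"
      by (rule emeasure_distr[symmetric]) (simp_all add: sect)
    finally show "emeasure odometer {y. (y, k) \<in> act a b c -` A} = emeasure odometer {y. (y, k + b) \<in> A}"
      by (simp add: distr_translate)
  qed
  also have "\<dots> = (\<integral>\<^sup>+k. emeasure odometer {y. (y, k) \<in> A} \<partial>count_space UNIV)"
    by (rule nn_integral_bij_count_space[where g = "\<lambda>k. k + b" and f = "\<lambda>k. emeasure odometer {y. (y, k) \<in> A}"])
      (auto intro!: bij_betw_byWitness[where f' = "\<lambda>k. k - b"])
  also have "\<dots> = emeasure induced A" by (rule emeasure_induced[OF A, symmetric])
  finally show ?thesis .
qed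

lemma act_image_sets: "A \<in> sets induced \<Longrightarrow> act a b c ` A \<in> sets induced"
  unfolding act_image using measurable_sets[OF measurable_act, of A] by simp

lemma emeasure_induced_act_image: "A \<in> sets induced \<Longrightarrow> emeasure induced (act a b c ` A) = emeasure induced A"
  unfolding act_image by (rule emeasure_induced_vimage_act)

lemma distr_act: "distr induced induced (act a b c) = induced"
  by (rule measure_eqI) (auto simp: emeasure_distr emeasure_induced_vimage_act)

text \<open>Approximation by an algebra is available for finite measures only. So half of the error
  goes into cutting \<open>A\<close> down to finitely many fibres, the other half into approximating
  inside this window. The bound on \<open>L\<close> will let it fit into a tower.\<close>

lemma approx_by_cyl:
  assumes A: "A \<in> sets induced" "emeasure induced A < \<infinity>" and "\<epsilon> > 0"
  obtains n j L where "cyl n L" "L \<subseteq> UNIV \<times> {- int j..int j}" "emeasure induced (sym_diff A L) < ennreal \<epsilon>"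
proof -
  define Z where "Z j = (UNIV :: (nat \<Rightarrow> int \<times> int) set) \<times> {- int j..int j}" for j
  have cyl_Z: "cyl 0 (Z j)" for j by (auto simp: cyl_def Z_def)
  then have Z [measurable]: "Z j \<in> sets induced" for j by (rule cyl_in_sets_induced)
  note A(1) [measurable]
  have "(\<lambda>j. emeasure induced (A - Z j)) \<longlonglongrightarrow> emeasure induced (\<Inter>j. A - Z j)"
  proof (rule Lim_emeasure_decseq)
    have "emeasure induced (A - Z j) \<le> emeasure induced A" for j
      using A(1) by (intro emeasure_mono) auto
    then show "emeasure induced (A - Z j) \<noteq> \<infinity>" for j
      using A(2) by (metis infinity_ennreal_def leD)
    show "range (\<lambda>j. A - Z j) \<subseteq> sets induced" by auto
  qed (auto simp: decseq_def Z_def)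
  moreover have "(\<Inter>j. A - Z j) = {}"
  proof -
    have "x \<in> Z (nat \<bar>snd x\<bar>)" for x by (cases x) (auto simp: Z_def)
    then show ?thesis by blast
  qed
  ultimately have "(\<lambda>j. emeasure induced (A - Z j)) \<longlonglongrightarrow> 0" by (simp only: emeasure_empty)
  then have "\<forall>\<^sub>F j in sequentially. emeasure induced (A - Z j) < ennreal (\<epsilon> / 2)"
    using \<open>\<epsilon> > 0\<close> by (intro order_tendstoD(2)) auto
  then obtain j where j: "emeasure induced (A - Z j) < ennreal (\<epsilon> / 2)"
    using eventually_happens'[OF sequentially_bot] by blast
  let ?N = "density induced (indicator (Z j))"
  have N: "emeasure ?N B = emeasure induced (Z j \<inter> B)" if "B \<in> sets induced" for B
    using that by (intro emeasure_restricted) auto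
  interpret N: finite_measure ?N
  proof
    have "emeasure induced (Z j) = ennreal (2 * j + 1)"
      unfolding Z_def emeasure_induced_UNIV_Times by (simp add: ennreal_of_nat_eq_real_of_nat)
    then show "emeasure ?N (space ?N) \<noteq> \<infinity>"
      using N[of UNIV] sets.top[of induced] by simp
  qed
  obtain n L where L: "cyl n L" "measure ?N (sym_diff A L) < \<epsilon> / 2"
    using N.approx_by_generating_algebra[of "{L. \<exists>n. cyl n L}" A "\<epsilon> / 2"] algebra_cyl A(1) \<open>\<epsilon> > 0\<close>
      sets_induced_eq_sigma_cyl by auto
  have L_sets [measurable]: "L \<in> sets induced" using L(1) by (rule cyl_in_sets_induced)
  have "cyl n (L \<inter> Z j)"
    using L(1) cyl_mono[OF cyl_Z[of j]] unfolding cyl_def by blast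
  moreover have "L \<inter> Z j \<subseteq> UNIV \<times> {- int j..int j}" by (auto simp: Z_def)
  moreover have "emeasure induced (sym_diff A (L \<inter> Z j)) < ennreal \<epsilon>"
  proof -
    have "emeasure induced (sym_diff A (L \<inter> Z j)) \<le> emeasure induced ((A - Z j) \<union> (Z j \<inter> sym_diff A L))"
      by (intro emeasure_mono) auto
    also have "\<dots> \<le> emeasure induced (A - Z j) + emeasure induced (Z j \<inter> sym_diff A L)"
      by (intro emeasure_subadditive) auto
    also have "emeasure induced (Z j \<inter> sym_diff A L) = emeasure ?N (sym_diff A L)"
      by (rule N[symmetric]) auto
    also have "\<dots> = ennreal (measure ?N (sym_diff A L))"
      by (rule N.emeasure_eq_measure)
    also have "emeasure induced (A - Z j) + \<dots> < ennreal (\<epsilon> / 2) + ennreal (\<epsilon> / 2)"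
      using j L(2) \<open>\<epsilon> > 0\<close> by (intro add_strict_mono) (auto simp: ennreal_less_iff)
    also have "\<dots> = ennreal \<epsilon>"
      using \<open>\<epsilon> > 0\<close> by (simp flip: ennreal_plus)
    finally show ?thesis .
  qed
  ultimately show ?thesis by (rule that)
qed

text \<open>Fibre \<open>k\<close> is translated by \<open>(a, c + a * k)\<close>, and
  \<open>h l\<close> divides both components whatever \<open>k\<close> is, so the first
  \<open>l\<close> coordinates stay fixed on every fibre.\<close>

lemma act_cyl_image:
  assumes "cyl n L" "n \<le> l" "h l dvd a" "h l dvd c"
  shows "act a 0 c ` L = L"
proof -
  have "(act a 0 c x \<in> L) = (x \<in> L)" if "h l dvd a" "h l dvd c" for a c x
  proof (cases x)
    case (Pair y k)
    have "translate (a, c + a * k) y i = y i" if "i < n" for i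
    proof -
      have "m i dvd a" "m i dvd c"
        using \<open>i < n\<close> \<open>n \<le> l\<close> \<open>h l dvd a\<close> \<open>h l dvd c\<close> by (auto simp: h_dvd_iff)
      then show ?thesis by (simp add: translate_def shift_dvd)
    qed
    then show ?thesis using assms(1) Pair by (auto simp: act_def cyl_def)
  qed
  from this[of "- a" "- c"] show ?thesis
    using assms(3,4) by (simp add: act_image vimage_def)
qed

text \<open>A cylinder \<open>L\<close> close to \<open>A\<close> is eventually invariant, so the
  part of \<open>A\<close> outside its image lies in \<open>sym_diff A L\<close> and the image of
  \<open>L - A\<close>. Both have measure below half of the gap \<open>r - q\<close>.\<close>

lemma rigid_induced:
  assumes dvd: "\<And>n. h n dvd a n \<and> h n dvd c n" and A: "A \<in> sets induced" "emeasure induced A < \<infinity>"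
  shows "(\<lambda>n. emeasure induced (A \<inter> act (a n) 0 (c n) ` A)) \<longlonglongrightarrow> emeasure induced A"
proof (rule order_tendstoI)
  fix e assume "e > emeasure induced A"
  moreover have "emeasure induced (A \<inter> act (a n) 0 (c n) ` A) \<le> emeasure induced A" for n
    using A(1) by (intro emeasure_mono) auto
  ultimately show "\<forall>\<^sub>F n in sequentially. emeasure induced (A \<inter> act (a n) 0 (c n) ` A) < e"
    by (intro always_eventually allI) (meson le_less_trans)
next
  fix e assume e: "e < emeasure induced A"
  obtain r where r: "r \<ge> 0" "emeasure induced A = ennreal r" using A(2) by (cases "emeasure induced A") auto
  obtain q where q: "q \<ge> 0" "e = ennreal q" using e A(2) by (cases e) auto
  have "q < r" using e r q by (simp add: ennreal_less_iff)
  then have "(r - q) / 2 > 0" by simp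
  then obtain n j L where L: "cyl n L" "L \<subseteq> UNIV \<times> {- int j..int j}" 
      "emeasure induced (sym_diff A L) < ennreal ((r - q) / 2)"
    by (rule approx_by_cyl[OF A])
  have L_sets: "L \<in> sets induced" using L(1) by (rule cyl_in_sets_induced)
  have "e < emeasure induced (A \<inter> act (a l) 0 (c l) ` A)" if "l \<ge> n" for l
  proof (rule ccontr)
    let ?T = "act (a l) 0 (c l)"
    assume "\<not> ?thesis"
    then have small: "emeasure induced (A \<inter> ?T ` A) \<le> ennreal q" using q by simp
    have TL: "?T ` L = L" using act_cyl_image[OF L(1) that] dvd by blast
    have T_sets: "?T ` B \<in> sets induced" if "B \<in> sets induced" for B using that by (rule act_image_sets)
    have "L - ?T ` A \<subseteq> ?T ` (L - A)"
      using TL by blast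
    then have "A \<subseteq> (A \<inter> ?T ` A) \<union> (sym_diff A L \<union> ?T ` (L - A))" by blast
    then have "ennreal r \<le> emeasure induced ((A \<inter> ?T ` A) \<union> (sym_diff A L \<union> ?T ` (L - A)))"
      unfolding r(2)[symmetric] using A(1) L_sets T_sets by (intro emeasure_mono) auto
    also have "\<dots> \<le> emeasure induced (A \<inter> ?T ` A) + emeasure induced (sym_diff A L \<union> ?T ` (L - A))"
      using A(1) L_sets T_sets by (intro emeasure_subadditive) auto
    also have "\<dots> \<le> emeasure induced (A \<inter> ?T ` A) + (emeasure induced (sym_diff A L) + emeasure induced (?T ` (L - A)))"
      using A(1) L_sets T_sets by (intro add_mono emeasure_subadditive) auto
    also have "emeasure induced (?T ` (L - A)) = emeasure induced (L - A)"
      using A(1) L_sets by (intro emeasure_induced_act_image) auto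
    also have "\<dots> \<le> emeasure induced (sym_diff A L)"
      using A(1) L_sets by (intro emeasure_mono) auto
    finally have "ennreal r \<le> ennreal q + (emeasure induced (sym_diff A L) + emeasure induced (sym_diff A L))"
      using small by (meson add_mono order_refl order_trans)
    also have "\<dots> < ennreal q + (ennreal ((r - q) / 2) + ennreal ((r - q) / 2))"
      using L(3) by (intro ennreal_add_left_cancel_less[THEN iffD2] conjI add_strict_mono) auto
    also have "\<dots> = ennreal r"
      using q \<open>q < r\<close> by (simp flip: ennreal_plus)
    finally show False by simp
  qed
  then show "\<forall>\<^sub>F n in sequentially. e < emeasure induced (A \<inter> act (a n) 0 (c n) ` A)"
    by (auto simp: eventually_sequentially)
qed

text \<open>A fixed point with coordinates in their squares forces \<open>b = 0\<close> and makes
  \<open>a\<close> and \<open>c + a * k\<close> divisible by every \<open>h n\<close>. As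
  \<open>h n\<close> is unbounded, both vanish.\<close>

lemma free_induced:
  assumes "a \<noteq> 0 \<or> b \<noteq> 0 \<or> c \<noteq> 0"
  shows "AE x in induced. act a b c x \<noteq> x"
  using AE_induced
proof eventually_elim
  case (elim x)
  obtain y k where x: "x = (y, k)" by (cases x)
  show ?case
  proof
    assume "act a b c x = x"
    then have "translate (a, c + a * k) y = y" and b: "b = 0"
      by (simp_all add: x act_def)
    then have "m i dvd a \<and> m i dvd c + a * k" for i
      using elim shift_eq_self_iff[of "y i" "m i" "(a, c + a * k)"]
      by (auto simp: x translate_def fun_eq_iff)
    then have dvd: "h n dvd a" "h n dvd c + a * k" for n
      by (auto simp: h_dvd_iff)
    have zero: "z = 0" if "\<And>n. h n dvd z" for z
      using dvd_imp_le_int[OF _ that, of "nat \<bar>z\<bar>"] h_gt[of "nat \<bar>z\<bar>"] by (cases "z = 0") auto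
    have "a = 0" using dvd(1) by (rule zero)
    moreover have "c + a * k = 0" using dvd(2) by (rule zero)
    ultimately show False using assms b by simp
  qed
qed

section \<open>Towers\<close>

definition level :: "nat \<Rightarrow> int \<Rightarrow> int \<Rightarrow> int \<Rightarrow> ((nat \<Rightarrow> int \<times> int) \<times> int) set" where
  "level n a k c = {y. \<forall>i<n. y i = (a mod m i, c mod m i)} \<times> {k}"

definition base :: "nat \<Rightarrow> ((nat \<Rightarrow> int \<times> int) \<times> int) set" where
  "base n = level n 0 0 0"

text \<open>The side \<open>h n\<close> is the number of residues, so each occurs exactly once. The
  range of \<open>k\<close> must grow to exhaust the fibres, but slowly compared with
  \<open>h n\<close>, because left multiplication shears the third coordinate by a multiple of
  \<open>k\<close>.\<close>

definition blocks :: "nat \<Rightarrow> (int \<times> int \<times> int) set" where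
  "blocks n = {0..<h n} \<times> {- int n..int n} \<times> {0..<h n}"

lemma cyl_level: "cyl n (level n a k c)"
  by (auto simp: cyl_def level_def)

lemma level_sets: "level n a k c \<in> sets induced"
  using cyl_level by (rule cyl_in_sets_induced)

text \<open>The base lies in fibre 0, where the shear vanishes; hence the levels are indexed
  directly by the entries of the group element.\<close>

lemma act_base: "act a k c ` base n = level n a k c"
proof -
  have 1: "shift (m i) (a, c) (0, 0) = (a mod m i, c mod m i)" for i a c
    using m_pos[of i] by (simp add: shift_def residue_square_def)
  have 2: "shift (m i) (- a, - c) (a mod m i, c mod m i) = (0, 0)" for i
    using m_pos[of i] by (simp add: shift_def residue_square_def mod_simps)
  show ?thesis
  proof
    show "act a k c ` base n \<subseteq> level n a k c"
      by (auto simp: base_def level_def act_def translate_def 1)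
    show "level n a k c \<subseteq> act a k c ` base n"
    proof
      fix x assume "x \<in> level n a k c"
      then obtain y where x: "x = (y, k)" and y: "\<And>i. i < n \<Longrightarrow> y i = (a mod m i, c mod m i)"
        by (auto simp: level_def)
      then show "x \<in> act a k c ` base n"
        unfolding act_image by (auto simp: base_def level_def act_def translate_def 2)
    qed
  qed
qed

lemma emeasure_base: "0 < emeasure induced (base n)" "emeasure induced (base n) < \<infinity>"
proof -
  interpret product_prob_space "\<lambda>i. measure_pmf (residue_pmf i)" UNIV
    by (rule product_prob_space_residue)
  let ?B = "{y. \<forall>i\<in>{..<n}. y i \<in> {(0, 0)}}"
  have "emeasure odometer {y \<in> space odometer. \<forall>i\<in>{..<n}. y i \<in> {(0, 0)}}
      = (\<Prod>i<n. emeasure (measure_pmf (residue_pmf i)) {(0, 0)})"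
    unfolding odometer_def by (intro emeasure_PiM_Collect) auto
  moreover have "{y \<in> space odometer. \<forall>i\<in>{..<n}. y i = (0, 0)} \<in> sets odometer"
    unfolding odometer_def by measurable
  moreover have "base n = ?B \<times> {0}" by (auto simp: base_def level_def)
  ultimately have eq: "emeasure induced (base n) = (\<Prod>i<n. emeasure (measure_pmf (residue_pmf i)) {(0, 0)})"
    using emeasure_induced_Times[of ?B "{0}"] by simp
  have "(0, 0) \<in> set_pmf (residue_pmf i)" for i
    using m_pos[of i] by (simp add: set_residue_pmf residue_square_def)
  then have "pmf (residue_pmf i) (0, 0) > 0" for i by (simp add: pmf_positive)
  then show "0 < emeasure induced (base n)" "emeasure induced (base n) < \<infinity>"
    unfolding eq by (auto simp: emeasure_pmf_single prod_ennreal intro!: prod_pos)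
qed

lemma disjoint_levels: "disjoint_family_on (\<lambda>(a, k, c). level n a k c) (blocks n)"
proof (unfold disjoint_family_on_def, intro ballI impI)
  fix p q assume p: "p \<in> blocks n" and q: "q \<in> blocks n" and "p \<noteq> q"
  obtain a k c a' k' c' where [simp]: "p = (a, k, c)" "q = (a', k', c')" by (metis prod_cases3)
  {
    fix x assume "x \<in> level n a k c" "x \<in> level n a' k' c'"
    then have "k = k'" "\<And>i. i < n \<Longrightarrow> a mod m i = a' mod m i" "\<And>i. i < n \<Longrightarrow> c mod m i = c' mod m i"
      by (auto simp: level_def)
    then have "p = q"
      using p q chinese_remainder_h_unique[of a n a'] chinese_remainder_h_unique[of c n c']
      by (auto simp: blocks_def)
  }
  then show "(case p of (a, k, c) \<Rightarrow> level n a k c) \<inter> (case q of (a, k, c) \<Rightarrow> level n a k c) = {}"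
    using \<open>p \<noteq> q\<close> by auto
qed

lemma cyl_eq_levels:
  assumes L: "cyl n' L" "L \<subseteq> UNIV \<times> {- int j..int j}" and n: "n' \<le> n" "j \<le> n"
    and x: "\<forall>i. fst x i \<in> residue_square (m i)"
  shows "x \<in> L \<longleftrightarrow> x \<in> (\<Union>(a, k, c)\<in>{(a, k, c)\<in>blocks n. level n a k c \<subseteq> L}. level n a k c)"
proof
  assume "x \<in> L"
  obtain y k where [simp]: "x = (y, k)" by (cases x)
  obtain a where a: "a \<in> {0..<h n}" "\<And>i. i < n \<Longrightarrow> a mod m i = fst (y i) mod m i"
    using chinese_remainder_h[of n "\<lambda>i. fst (y i)"] by blast
  obtain c where c: "c \<in> {0..<h n}" "\<And>i. i < n \<Longrightarrow> c mod m i = snd (y i) mod m i"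
    using chinese_remainder_h[of n "\<lambda>i. snd (y i)"] by blast
  \<comment> \<open>Membership in the squares enters here: it makes each coordinate equal to its own
    residue.\<close>
  have y: "y i = (a mod m i, c mod m i)" if "i < n" for i
    using x a(2)[OF that] c(2)[OF that] by (cases "y i") (auto simp: residue_square_def dest!: spec[of _ i])
  have "(a, k, c) \<in> blocks n" using a c L(2) \<open>x \<in> L\<close> n by (auto simp: blocks_def)
  moreover have "level n a k c \<subseteq> L"
  proof
    fix z assume "z \<in> level n a k c"
    then obtain y' where "z = (y', k)" "\<And>i. i < n \<Longrightarrow> y i = y' i" using y by (auto simp: level_def)
    then show "z \<in> L" using cyl_mono[OF L(1) n(1)] \<open>x \<in> L\<close> unfolding cyl_def by auto
  qed
  moreover have "x \<in> level n a k c" using y by (simp add: level_def)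
  ultimately show "x \<in> (\<Union>(a, k, c)\<in>{(a, k, c)\<in>blocks n. level n a k c \<subseteq> L}. level n a k c)"
    by (intro UN_I[of "(a, k, c)"]) auto
qed auto

text \<open>Once \<open>n\<close> reaches the length and the fibre range of a cylinder close to
  \<open>A\<close>, this cylinder is a union of levels up to a null set, so no further error
  arises.\<close>

lemma approx_by_levels:
  assumes A: "A \<in> sets induced" "emeasure induced A < \<infinity>" and "\<epsilon> > 0"
  shows "\<forall>\<^sub>F n in sequentially. \<exists>F\<subseteq>blocks n. emeasure induced (sym_diff A (\<Union>(a, k, c)\<in>F. level n a k c)) < ennreal \<epsilon>"
proof -
  obtain n' j L where L: "cyl n' L" "L \<subseteq> UNIV \<times> {- int j..int j}" "emeasure induced (sym_diff A L) < ennreal \<epsilon>"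
    by (rule approx_by_cyl[OF assms])
  have L_sets: "L \<in> sets induced" using L(1) by (rule cyl_in_sets_induced)
  have "\<exists>F\<subseteq>blocks n. emeasure induced (sym_diff A (\<Union>(a, k, c)\<in>F. level n a k c)) < ennreal \<epsilon>"
    if n: "n \<ge> max n' j" for n
  proof -
    define F where "F = {(a, k, c)\<in>blocks n. level n a k c \<subseteq> L}"
    let ?U = "\<Union>(a, k, c)\<in>F. level n a k c"
    have "finite (blocks n)" by (simp add: blocks_def)
    then have "finite F" unfolding F_def by (rule rev_finite_subset) auto
    then have U: "?U \<in> sets induced" by (intro sets.finite_UN) (auto intro: level_sets)
    have "AE x in induced. x \<in> L \<longleftrightarrow> x \<in> ?U"
      using AE_induced
    proof eventually_elim
      case (elim x)
      then show ?case
        unfolding F_def using n by (intro cyl_eq_levels[OF L(1,2)]) auto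
    qed
    then have "AE x in induced. x \<in> sym_diff A L \<longleftrightarrow> x \<in> sym_diff A ?U"
      by eventually_elim auto
    then have "emeasure induced (sym_diff A L) = emeasure induced (sym_diff A ?U)"
      using A(1) L_sets U by (intro emeasure_eq_AE) auto
    then show ?thesis using L(3) by (intro exI[of _ F]) (auto simp: F_def)
  qed
  then show ?thesis unfolding eventually_sequentially by blast
qed

section \<open>Standardness of the induced space\<close>

definition cantor_topology :: "((nat \<Rightarrow> int \<times> int) \<times> int) topology" where
  "cantor_topology =
     prod_topology (product_topology (\<lambda>_. discrete_topology UNIV) UNIV) (discrete_topology UNIV)"

lemma openin_cell: "openin cantor_topology (cell l k)"
proof -
  let ?C = "\<lambda>i. if i < length l then {l ! i} else UNIV"
  have "{y. \<forall>i\<in>{..<length l}. y i = l ! i} = (\<Pi>\<^sub>E i\<in>UNIV. ?C i)"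
    by (auto simp: PiE_iff split: if_splits)
  moreover have "finite {i \<in> UNIV. ?C i \<noteq> topspace (discrete_topology UNIV)}"
    by (rule finite_subset[of _ "{..<length l}"]) auto
  ultimately show ?thesis
    unfolding cantor_topology_def cell_def
    by (intro openin_prod_Times_iff[THEN iffD2] disjI2 conjI)
      (auto intro!: product_topology_basis)
qed

text \<open>A basic open set of the product constrains finitely many coordinates, all below some
  \<open>n\<close>; fixing the first \<open>n\<close> coordinates and the fibre refines it.\<close>

lemma openin_cantor_topology_cell:
  assumes "openin cantor_topology U" "x \<in> U"
  shows "\<exists>l k. x \<in> cell l k \<and> cell l k \<subseteq> U"
proof -
  obtain y k where x: "x = (y, k)" by (cases x)
  obtain V where V: "openin (product_topology (\<lambda>_. discrete_topology UNIV) UNIV) V" "y \<in> V" "V \<times> {k} \<subseteq> U"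
  proof -
    have "\<exists>V K. openin (product_topology (\<lambda>_. discrete_topology UNIV) UNIV) V \<and>
        openin (discrete_topology UNIV) K \<and> y \<in> V \<and> k \<in> K \<and> V \<times> K \<subseteq> U"
      using assms unfolding x cantor_topology_def openin_prod_topology_alt by blast
    then show ?thesis using that by blast
  qed
  obtain W where W: "finite {i. W i \<noteq> UNIV}" "y \<in> Pi\<^sub>E UNIV W" "Pi\<^sub>E UNIV W \<subseteq> V"
    using V(1,2) unfolding openin_product_topology_alt by auto
  obtain n where n: "{i. W i \<noteq> UNIV} \<subseteq> {..<n}"
    using finite_nat_bounded[OF W(1)] by blast
  have "cell (map y [0..<n]) k \<subseteq> V \<times> {k}"
  proof
    fix z assume "z \<in> cell (map y [0..<n]) k"
    then obtain y' where y': "z = (y', k)" "\<And>i. i < n \<Longrightarrow> y' i = y i" by (auto simp: cell_def)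
    have "y' i \<in> W i" for i
    proof (cases "i < n")
      case True then show ?thesis using y'(2) W(2) by (auto simp: PiE_iff)
    next
      case False then show ?thesis using n by auto
    qed
    then show "z \<in> V \<times> {k}" using W(3) y'(1) by (auto simp: PiE_iff)
  qed
  then show ?thesis using V(3) mem_cell_map x by blast
qed

lemma sets_induced_eq_sigma_open: "sets induced = sigma_sets (space induced) {U. openin cantor_topology U}"
proof
  have "L \<in> sigma_sets UNIV {U. openin cantor_topology U}" if L: "cyl n L" for n L
  proof -
    have "openin cantor_topology (\<Union>(l, k)\<in>{(l, k). cell l k \<subseteq> L}. cell l k)"
      using openin_cell by (intro openin_Union) auto
    then show ?thesis using cyl_eq_Union_cells[OF L] by auto
  qed
  then show "sets induced \<subseteq> sigma_sets (space induced) {U. openin cantor_topology U}"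
    unfolding sets_induced_eq_sigma_cyl space_induced by (intro sigma_sets_mono) auto
next
  have "U \<in> sets induced" if "openin cantor_topology U" for U
  proof -
    have "U = (\<Union>(l, k)\<in>{(l, k). cell l k \<subseteq> U}. cell l k)"
      using openin_cantor_topology_cell[OF that] by fast
    then show ?thesis using Union_cells_in_sets_induced by metis
  qed
  then show "sigma_sets (space induced) {U. openin cantor_topology U} \<subseteq> sets induced"
    by (intro sets.sigma_sets_subset) auto
qed

lemma standard_borel_induced: "standard_borel_measure induced"
  unfolding standard_borel_measure_def
proof (intro exI conjI)
  show "completely_metrizable_space cantor_topology"
    by (simp add: cantor_topology_def completely_metrizable_space_prod_topology
        completely_metrizable_space_product_topology completely_metrizable_space_discrete_topology)
  show "second_countable cantor_topology"
    unfolding second_countable_def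
  proof (intro exI conjI allI impI)
    show "countable (range (\<lambda>(l, k). cell l k))" by simp
    show "\<forall>V\<in>range (\<lambda>(l, k). cell l k). openin cantor_topology V" using openin_cell by auto
    fix U x assume "openin cantor_topology U \<and> x \<in> U"
    then obtain l k where "x \<in> cell l k" "cell l k \<subseteq> U"
      using openin_cantor_topology_cell by blast
    then show "\<exists>V\<in>range (\<lambda>(l, k). cell l k). x \<in> V \<and> V \<subseteq> U"
      by (intro bexI[of _ "cell l k"] conjI range_eqI[of _ _ "(l, k)"]) auto
  qed
  show "topspace cantor_topology = space induced"
    by (simp add: cantor_topology_def)
  show "sets induced = sigma_sets (space induced) {U. openin cantor_topology U}"
    by (rule sets_induced_eq_sigma_open)
qed

section \<open>The action of the integer Heisenberg group and its towers\<close>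

text \<open>The floors only read integers off a real matrix; outside \<open>H3Z\<close> they give a
  default value.\<close>

definition heis_act :: "real^3^3 \<Rightarrow> (nat \<Rightarrow> int \<times> int) \<times> int \<Rightarrow> (nat \<Rightarrow> int \<times> int) \<times> int" where
  "heis_act \<gamma> = act \<lfloor>\<gamma>$1$2\<rfloor> \<lfloor>\<gamma>$2$3\<rfloor> \<lfloor>\<gamma>$1$3\<rfloor>"

lemma heis_act_heis [simp]: "heis_act (heis (of_int a) (of_int b) (of_int c)) = act a b c"
  by (simp add: heis_act_def)

lemma mp_action_induced: "mp_action induced heis_act"
  unfolding mp_action_def
proof (intro conjI ballI)
  fix \<gamma> \<delta> x assume "\<gamma> \<in> H3Z" "\<delta> \<in> H3Z"
  then obtain a b c a' b' c' :: int
    where \<gamma>\<delta>: "\<gamma> = heis (of_int a) (of_int b) (of_int c)" "\<delta> = heis (of_int a') (of_int b') (of_int c')"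
    by (meson H3Z_E)
  have "\<gamma> ** \<delta> = heis (of_int (a + a')) (of_int (b + b')) (of_int (c + c' + a * b'))"
    unfolding \<gamma>\<delta> heis_mult by simp
  then show "heis_act (\<gamma> ** \<delta>) x = heis_act \<gamma> (heis_act \<delta> x)"
    unfolding \<gamma>\<delta> by (simp only: heis_act_heis act_act)
next
  show "heis_act (mat 1) x = x" for x by (simp add: heis_act_def)
qed (auto simp: heis_act_def distr_act)

lemma free_action_induced: "free_action induced heis_act"
  unfolding free_action_def
proof
  fix \<gamma> assume "\<gamma> \<in> H3Z - {mat 1}"
  then obtain a b c :: int where "\<gamma> = heis (of_int a) (of_int b) (of_int c)" "a \<noteq> 0 \<or> b \<noteq> 0 \<or> c \<noteq> 0"
    by (auto elim: H3Z_E)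
  then show "AE x in induced. heis_act \<gamma> x \<noteq> x" using free_induced by simp
qed

text \<open>The points that leave occupy the last or the first \<open>|s|\<close> places of the
  interval, according to the sign of \<open>s\<close>.\<close>

lemma card_shift_escape:
  "card {x \<in> {p..<q::int}. x + s \<notin> {p..<q}} \<le> nat \<bar>s\<bar>"
proof (cases "s \<ge> 0")
  case True
  have "card {x \<in> {p..<q::int}. x + s \<notin> {p..<q}} \<le> card {q - s..<q}"
    using True by (intro card_mono) auto
  then show ?thesis using True by simp
next
  case False
  have "card {x \<in> {p..<q::int}. x + s \<notin> {p..<q}} \<le> card {p..<p - s}"
    using False by (intro card_mono) auto
  then show ?thesis using False by simp
qed

text \<open>By injectivity the image has as many points as \<open>S\<close>, so the two one-sided
  differences have equal size, and one of them consists of images of escaping points.\<close>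

lemma card_sym_diff_image_le:
  assumes "finite S" "inj_on f S"
  shows "card (sym_diff (f ` S) S) \<le> 2 * card {x \<in> S. f x \<notin> S}"
proof -
  have "f ` S - S = f ` {x \<in> S. f x \<notin> S}" by auto
  then have 1: "card (f ` S - S) \<le> card {x \<in> S. f x \<notin> S}"
    using assms(1) card_image_le[of "{x \<in> S. f x \<notin> S}" f] by simp
  have "card (S - f ` S) = card S - card (f ` S \<inter> S)"
    using assms(1) by (metis card_Diff_subset_Int finite_Int inf_commute)
  also have "\<dots> = card (f ` S) - card (f ` S \<inter> S)"
    using assms by (simp add: card_image)
  also have "\<dots> = card (f ` S - S)"
    using assms(1) by (simp add: card_Diff_subset_Int)
  finally have 2: "card (S - f ` S) = card (f ` S - S)" .
  have "card (sym_diff (f ` S) S) \<le> card (f ` S - S) + card (S - f ` S)"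
    by (rule card_Un_le)
  then show ?thesis using 1 2 by simp
qed

lemma finite_blocks [simp]: "finite (blocks n)" and blocks_ne: "blocks n \<noteq> {}"
  using h_pos[of n] by (auto simp: blocks_def)

lemma card_blocks: "real (card (blocks n)) = (of_int (h n))\<^sup>2 * (2 * n + 1)"
  using h_pos[of n] by (simp add: blocks_def card_cartesian_product power2_eq_square nat_add_distrib algebra_simps)

text \<open>A triple escapes only if one of its coordinates leaves its interval, and each term
  accounts for one coordinate. The last carries the shear, with \<open>|a * k|\<close> at most
  \<open>|a| * n\<close>.\<close>

lemma card_blocks_escape:
  fixes a b c :: int
  shows "real (card {(x, k, z) \<in> blocks n. (a + x, b + k, c + z + a * k) \<notin> blocks n})
    \<le> \<bar>real_of_int a\<bar> * ((2 * real n + 1) * real_of_int (h n))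
      + real_of_int (h n) * (\<bar>real_of_int b\<bar> * real_of_int (h n))
      + real_of_int (h n) * ((2 * real n + 1) * (\<bar>real_of_int c\<bar> + \<bar>real_of_int a\<bar> * real n))"
proof -
  \<comment> \<open>The range of \<open>k\<close> is rewritten half-open, with upper end
    \<open>int n + 1\<close>, to match \<open>card_shift_escape\<close>.\<close>
  let ?I = "{0..<h n}" and ?K = "{- int n..<int n + 1}"
  let ?A = "{x \<in> ?I. x + a \<notin> ?I}" and ?B = "{k \<in> ?K. k + b \<notin> ?K}"
    and ?C = "\<lambda>k. {z \<in> ?I. z + (c + a * k) \<notin> ?I}"
  have fin: "finite ?I" "finite ?K" "finite ?A" "finite ?B" "finite (?C k)" for k
    by (rule finite_subset[of _ ?I] finite_subset[of _ ?K]; force)+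
  have "{(x, k, z) \<in> blocks n. (a + x, b + k, c + z + a * k) \<notin> blocks n}
      \<subseteq> ?A \<times> ?K \<times> ?I \<union> ?I \<times> ?B \<times> ?I \<union> ?I \<times> (SIGMA k : ?K. ?C k)"
  proof
    fix p assume "p \<in> {(x, k, z) \<in> blocks n. (a + x, b + k, c + z + a * k) \<notin> blocks n}"
    then obtain x k z where p: "p = (x, k, z)" "(x, k, z) \<in> blocks n"
        "(a + x, b + k, c + z + a * k) \<notin> blocks n"
      by blast
    have "x \<in> ?I" "k \<in> ?K" "z \<in> ?I" using p(2) by (simp_all add: blocks_def)
    moreover have "\<not> (x + a \<in> ?I \<and> k + b \<in> ?K \<and> z + (c + a * k) \<in> ?I)"
      using p(3) by (auto simp: blocks_def algebra_simps)
    ultimately show "p \<in> ?A \<times> ?K \<times> ?I \<union> ?I \<times> ?B \<times> ?I \<union> ?I \<times> (SIGMA k : ?K. ?C k)"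
      unfolding p(1) by blast
  qed
  then have "card {(x, k, z) \<in> blocks n. (a + x, b + k, c + z + a * k) \<notin> blocks n}
      \<le> card (?A \<times> ?K \<times> ?I \<union> ?I \<times> ?B \<times> ?I \<union> ?I \<times> (SIGMA k : ?K. ?C k))"
    by (intro card_mono finite_UnI finite_cartesian_product finite_SigmaI fin)
  also have "\<dots> \<le> card (?A \<times> ?K \<times> ?I) + card (?I \<times> ?B \<times> ?I) + card (?I \<times> (SIGMA k : ?K. ?C k))"
    by (meson add_mono card_Un_le order_refl order_trans)
  also have "\<dots> = card ?A * (card ?K * card ?I) + card ?I * (card ?B * card ?I) + card ?I * (\<Sum>k\<in>?K. card (?C k))"
  proof -
    have "card (SIGMA k : ?K. ?C k) = (\<Sum>k\<in>?K. card (?C k))"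
      by (intro card_SigmaI ballI fin)
    then show ?thesis by (simp only: card_cartesian_product)
  qed
  also have "\<dots> \<le> nat \<bar>a\<bar> * (card ?K * card ?I) + card ?I * (nat \<bar>b\<bar> * card ?I)
      + card ?I * (\<Sum>k\<in>?K. nat (\<bar>c\<bar> + \<bar>a\<bar> * n))"
  proof (intro add_mono mult_mono sum_mono card_shift_escape order_refl)
    fix k assume "k \<in> ?K"
    then have "\<bar>a * k\<bar> \<le> \<bar>a\<bar> * int n" unfolding abs_mult by (intro mult_left_mono) auto
    then have "nat \<bar>c + a * k\<bar> \<le> nat (\<bar>c\<bar> + \<bar>a\<bar> * n)" by linarith
    then show "card (?C k) \<le> nat (\<bar>c\<bar> + \<bar>a\<bar> * n)" using card_shift_escape order_trans by blast
  qed auto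
  finally have "real (card {(x, k, z) \<in> blocks n. (a + x, b + k, c + z + a * k) \<notin> blocks n})
      \<le> real (nat \<bar>a\<bar> * (card ?K * card ?I) + card ?I * (nat \<bar>b\<bar> * card ?I)
      + card ?I * (\<Sum>k\<in>?K. nat (\<bar>c\<bar> + \<bar>a\<bar> * n)))"
    by (rule of_nat_mono)
  also have "\<dots> = \<bar>real_of_int a\<bar> * ((2 * real n + 1) * real_of_int (h n))
      + real_of_int (h n) * (\<bar>real_of_int b\<bar> * real_of_int (h n))
      + real_of_int (h n) * ((2 * real n + 1) * (\<bar>real_of_int c\<bar> + \<bar>real_of_int a\<bar> * real n))"
    using h_pos[of n] by (simp add: nat_add_distrib algebra_simps)
  finally show ?thesis .
qed

definition tower_shape :: "nat \<Rightarrow> (real^3^3) set" where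
  "tower_shape n = (\<lambda>(a, k, c). heis (of_int a) (of_int k) (of_int c)) ` blocks n"

text \<open>Divided by the size of the box, the escape bound has terms of order
  \<open>1 / h n\<close>, \<open>1 / n\<close> and \<open>n / h n\<close>; the last tends to 0
  because \<open>h n\<close> grows at least exponentially.\<close>

lemma Folner_tower_shape: "Folner_sequence tower_shape"
  unfolding Folner_sequence_def
proof (intro conjI allI ballI)
  show "finite (tower_shape n)" "tower_shape n \<noteq> {}" "tower_shape n \<subseteq> H3Z" for n
    using blocks_ne by (auto simp: tower_shape_def)
next
  fix \<gamma> assume "\<gamma> \<in> H3Z"
  then obtain a b c :: int where \<gamma>: "\<gamma> = heis (of_int a) (of_int b) (of_int c)" by (rule H3Z_E)
  define \<eta> :: "int \<times> int \<times> int \<Rightarrow> real^3^3" where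
    "\<eta> = (\<lambda>(a, k, c). heis (of_int a) (of_int k) (of_int c))"
  have inj: "inj \<eta>" by (auto simp: inj_def \<eta>_def)
  define f where "f = (\<lambda>(x, k, z). (a + x, b + k, c + z + a * k))"
  have inj_f: "inj f" by (auto simp: inj_def f_def)
  have "(\<lambda>\<delta>. \<gamma> ** \<delta>) (\<eta> p) = \<eta> (f p)" for p
    by (cases p) (simp add: \<eta>_def f_def \<gamma> heis_mult)
  then have "(\<lambda>\<delta>. \<gamma> ** \<delta>) ` tower_shape n = \<eta> ` f ` blocks n" for n
    unfolding tower_shape_def \<eta>_def[symmetric] by (simp add: image_image)
  then have "sym_diff ((\<lambda>\<delta>. \<gamma> ** \<delta>) ` tower_shape n) (tower_shape n) = \<eta> ` sym_diff (f ` blocks n) (blocks n)" for n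
    unfolding tower_shape_def \<eta>_def[symmetric] using inj by (simp add: image_Un image_set_diff)
  then have card_eq: "card (sym_diff ((\<lambda>\<delta>. \<gamma> ** \<delta>) ` tower_shape n) (tower_shape n))
      = card (sym_diff (f ` blocks n) (blocks n))" for n
    using inj by (metis card_image inj_on_subset subset_UNIV)
  have card_shape: "card (tower_shape n) = card (blocks n)" for n
    unfolding tower_shape_def \<eta>_def[symmetric] using inj by (metis card_image inj_on_subset subset_UNIV)
  have bound: "real (card (sym_diff ((\<lambda>\<delta>. \<gamma> ** \<delta>) ` tower_shape n) (tower_shape n))) / real (card (tower_shape n))
      \<le> 2 * (\<bar>real_of_int a\<bar> / 2 ^ n + \<bar>real_of_int b\<bar> / (2 * real n + 1) + (\<bar>real_of_int c\<bar> + \<bar>real_of_int a\<bar> * real n) / 2 ^ n)" for n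
  proof -
    define H where "H = real_of_int (h n)"
    have "(2 :: int) ^ n \<le> h n" by (rule h_ge)
    then have H: "H \<ge> 2 ^ n" unfolding H_def by (metis of_int_le_iff of_int_numeral of_int_power)
    then have H0: "H > 0" using less_le_trans zero_less_power by (metis zero_less_numeral)
    have "card (sym_diff (f ` blocks n) (blocks n)) \<le> 2 * card {p \<in> blocks n. f p \<notin> blocks n}"
      using inj_f by (intro card_sym_diff_image_le) (auto intro: inj_on_subset)
    then have "real (card (sym_diff (f ` blocks n) (blocks n))) \<le> 2 * real (card {p \<in> blocks n. f p \<notin> blocks n})"
      by linarith
    also have "{p \<in> blocks n. f p \<notin> blocks n} = {(x, k, z) \<in> blocks n. (a + x, b + k, c + z + a * k) \<notin> blocks n}"
      by (auto simp: f_def)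
    also have "2 * real (card \<dots>)
        \<le> 2 * (\<bar>real_of_int a\<bar> * ((2 * real n + 1) * H) + H * (\<bar>real_of_int b\<bar> * H)
          + H * ((2 * real n + 1) * (\<bar>real_of_int c\<bar> + \<bar>real_of_int a\<bar> * real n)))"
      unfolding H_def by (intro mult_left_mono card_blocks_escape) simp
    finally have "real (card (sym_diff (f ` blocks n) (blocks n))) \<le> \<dots>" .
    then have "real (card (sym_diff (f ` blocks n) (blocks n))) / real (card (blocks n))
        \<le> 2 * (\<bar>real_of_int a\<bar> * ((2 * real n + 1) * H) + H * (\<bar>real_of_int b\<bar> * H)
          + H * ((2 * real n + 1) * (\<bar>real_of_int c\<bar> + \<bar>real_of_int a\<bar> * real n)))
          / (H\<^sup>2 * (2 * real n + 1))"
      unfolding card_blocks H_def by (intro divide_right_mono) auto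
    also have "\<dots> = 2 * (\<bar>real_of_int a\<bar> / H + \<bar>real_of_int b\<bar> / (2 * real n + 1) + (\<bar>real_of_int c\<bar> + \<bar>real_of_int a\<bar> * real n) / H)"
    proof -
      define N where "N = 2 * real n + 1"
      have "N > 0" by (simp add: N_def)
      then have "2 * (\<bar>real_of_int a\<bar> * (N * H) + H * (\<bar>real_of_int b\<bar> * H)
          + H * (N * (\<bar>real_of_int c\<bar> + \<bar>real_of_int a\<bar> * real n))) / (H\<^sup>2 * N)
          = 2 * (\<bar>real_of_int a\<bar> / H + \<bar>real_of_int b\<bar> / N + (\<bar>real_of_int c\<bar> + \<bar>real_of_int a\<bar> * real n) / H)"
        using H0 by (simp add: field_simps power2_eq_square)
      then show ?thesis by (simp add: N_def)
    qed
    also have "\<dots> \<le> 2 * (\<bar>real_of_int a\<bar> / 2 ^ n + \<bar>real_of_int b\<bar> / (2 * real n + 1) + (\<bar>real_of_int c\<bar> + \<bar>real_of_int a\<bar> * real n) / 2 ^ n)"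
      using H by (intro mult_left_mono add_mono divide_left_mono mult_pos_pos H0) auto
    finally show ?thesis unfolding card_eq card_shape .
  qed
  have "(\<lambda>n. 2 * (\<bar>real_of_int a\<bar> / 2 ^ n + \<bar>real_of_int b\<bar> / (2 * real n + 1) + (\<bar>real_of_int c\<bar> + \<bar>real_of_int a\<bar> * real n) / 2 ^ n)) \<longlonglongrightarrow> 0"
    by real_asymp
  from tendsto_sandwich[OF _ _ tendsto_const this]
  show "(\<lambda>n. real (card (sym_diff ((\<lambda>\<delta>. \<gamma> ** \<delta>) ` tower_shape n) (tower_shape n))) / real (card (tower_shape n))) \<longlonglongrightarrow> 0"
    using bound by (simp add: always_eventually)
qed

lemma rank_one_induced: "rank_one induced heis_act"
  unfolding rank_one_def
proof (intro exI conjI allI ballI impI)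
  show "Folner_sequence tower_shape" by (rule Folner_tower_shape)
  show "base n \<in> sets induced" for n by (simp add: base_def level_sets)
  show "0 < emeasure induced (base n)" "emeasure induced (base n) < \<infinity>" for n by (rule emeasure_base)+
  show "disjoint_family_on (\<lambda>\<gamma>. heis_act \<gamma> ` base n) (tower_shape n)" for n
  proof (unfold disjoint_family_on_def, intro ballI impI)
    fix \<gamma> \<delta> assume "\<gamma> \<in> tower_shape n" "\<delta> \<in> tower_shape n" "\<gamma> \<noteq> \<delta>"
    then obtain p q where "p \<in> blocks n" "q \<in> blocks n" "p \<noteq> q"
      and "\<gamma> = (case p of (a, k, c) \<Rightarrow> heis (of_int a) (of_int k) (of_int c))"
      and "\<delta> = (case q of (a, k, c) \<Rightarrow> heis (of_int a) (of_int k) (of_int c))"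
      unfolding tower_shape_def by blast
    moreover have "heis_act (case p of (a, k, c) \<Rightarrow> heis (of_int a) (of_int k) (of_int c)) ` base n
        = (case p of (a, k, c) \<Rightarrow> level n a k c)" for p
      by (cases p) (simp add: act_base)
    ultimately show "heis_act \<gamma> ` base n \<inter> heis_act \<delta> ` base n = {}"
      using disjoint_family_onD[OF disjoint_levels] by simp
  qed
next
  fix A assume A: "A \<in> sets induced" "emeasure induced A < \<infinity>"
  let ?\<mu> = "\<lambda>n F. emeasure induced (sym_diff A (\<Union>\<gamma>\<in>F. heis_act \<gamma> ` base n))"
  show "(\<lambda>n. Min (?\<mu> n ` Pow (tower_shape n))) \<longlonglongrightarrow> 0"
  proof (rule order_tendstoI)
    fix e :: ennreal assume "0 < e"
    then obtain e' where "0 < e'" "e' < e" using dense by blast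
    then obtain \<epsilon> where \<epsilon>: "\<epsilon> > 0" "ennreal \<epsilon> < e" by (cases e') auto
    show "\<forall>\<^sub>F n in sequentially. Min (?\<mu> n ` Pow (tower_shape n)) < e"
      using approx_by_levels[OF A \<epsilon>(1)]
    proof eventually_elim
      case (elim n)
      then obtain F where F: "F \<subseteq> blocks n" "emeasure induced (sym_diff A (\<Union>(a, k, c)\<in>F. level n a k c)) < ennreal \<epsilon>"
        by blast
      let ?F = "(\<lambda>(a, k, c). heis (of_int a) (of_int k) (of_int c)) ` F"
      have "(\<Union>\<gamma>\<in>?F. heis_act \<gamma> ` base n) = (\<Union>(a, k, c)\<in>F. level n a k c)"
        by (simp add: image_image case_prod_beta' act_base)
      moreover have "?F \<in> Pow (tower_shape n)" unfolding tower_shape_def using F(1) by (intro PowI image_mono)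
      moreover have "finite (Pow (tower_shape n))" by (simp add: tower_shape_def)
      ultimately have "Min (?\<mu> n ` Pow (tower_shape n)) \<le> emeasure induced (sym_diff A (\<Union>(a, k, c)\<in>F. level n a k c))"
        by (intro Min_le) (auto intro!: image_eqI[of _ _ ?F])
      then show ?case using F(2) \<epsilon>(2) by (meson le_less_trans less_trans)
    qed
  qed simp
qed

end

section \<open>Transport to the real line\<close>

text \<open>The topology is transported along with the measure, so the injection \<open>\<phi>\<close> need not be measurable
  with respect to any structure on its codomain.\<close>

locale measure_embedding =
  fixes M :: "'a measure" and T :: "real^3^3 \<Rightarrow> 'a \<Rightarrow> 'a" and \<phi> :: "'a \<Rightarrow> 'b"
  assumes inj: "inj \<phi>"
begin

definition M' :: "'b measure" where "M' = embed_measure M \<phi>"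

definition T' :: "real^3^3 \<Rightarrow> 'b \<Rightarrow> 'b" where "T' \<gamma> = \<phi> \<circ> T \<gamma> \<circ> inv \<phi>"

lemma T'_apply [simp]: "T' \<gamma> (\<phi> x) = \<phi> (T \<gamma> x)"
  by (simp add: T'_def inj)

lemma T'_image [simp]: "T' \<gamma> ` \<phi> ` A = \<phi> ` T \<gamma> ` A"
  by (simp add: image_image)

lemma space_M' [simp]: "space M' = \<phi> ` space M"
  by (simp add: M'_def space_embed_measure)

lemma sets_M': "sets M' = (`) \<phi> ` sets M"
  unfolding M'_def using sets_embed_measure[OF inj] by blast

lemma emeasure_M' [simp]: "A \<in> sets M \<Longrightarrow> emeasure M' (\<phi> ` A) = emeasure M A"
  unfolding M'_def using inj by (rule emeasure_embed_measure_image)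

lemma measurable_\<phi> [measurable]: "\<phi> \<in> measurable M M'"
  unfolding M'_def using inj by (rule measurable_embed_measure2)

lemma M'_eq_distr: "M' = distr M M' \<phi>"
  unfolding M'_def using inj by (rule embed_measure_eq_distr)

text \<open>With the transported topology \<open>\<phi>\<close> is a homeomorphism onto its image,
  and generating a sigma-algebra commutes with preimages under \<open>inv \<phi>\<close>.\<close>

lemma standard_borel_M':
  assumes "standard_borel_measure M" shows "standard_borel_measure M'"
proof -
  obtain X where X: "completely_metrizable_space X" "second_countable X"
    "topspace X = space M" "sets M = sigma_sets (space M) {U. openin X U}"
    using assms unfolding standard_borel_measure_def by blast
  define Y where "Y = pullback_topology (range \<phi>) (inv \<phi>) X"
  have vimage: "inv \<phi> -` U \<inter> range \<phi> = \<phi> ` U" for U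
    using inj by (auto simp: image_iff)
  have openin_Y: "openin Y S \<longleftrightarrow> (\<exists>U. openin X U \<and> S = \<phi> ` U)" for S
    unfolding Y_def openin_pullback_topology vimage ..
  have topspace_Y: "topspace Y = \<phi> ` space M"
    unfolding Y_def topspace_pullback_topology vimage X(3) ..
  have "homeomorphic_map X Y \<phi>"
  proof (rule bijective_open_imp_homeomorphic_map)
    have "{x \<in> topspace X. \<phi> x \<in> V} = U" if "openin X U" "V = \<phi> ` U" for U V
      using that inj openin_subset[OF that(1)] by (auto dest: injD)
    then show "continuous_map X Y \<phi>"
      unfolding continuous_map_def openin_Y using X(3) topspace_Y by (auto simp: Pi_iff)
  qed (use inj X(3) topspace_Y in \<open>auto simp: open_map_def openin_Y intro: inj_on_subset\<close>)
  then have hom: "X homeomorphic_space Y" by (rule homeomorphic_map_imp_homeomorphic_space)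
  have "sets M' = sigma_sets (space M') {U. openin Y U}"
  proof -
    have sub: "{U. openin X U} \<subseteq> Pow (space M)" using openin_subset X(3) by fastforce
    have "sets M' = {inv \<phi> -` A \<inter> \<phi> ` space M |A. A \<in> sigma_sets (space M) {U. openin X U}}"
    proof -
      have "inv \<phi> -` A \<inter> \<phi> ` space M = \<phi> ` A" if "A \<in> sets M" for A
        using inj sets.sets_into_space[OF that] by (auto simp: image_iff)
      then show ?thesis unfolding X(4)[symmetric] sets_M' by (auto simp: image_iff) metis+
    qed
    also have "\<dots> = sigma_sets (\<phi> ` space M) {inv \<phi> -` A \<inter> \<phi> ` space M |A. A \<in> {U. openin X U}}"
      using inj by (intro sigma_sets_vimage_commute) auto
    also have "{inv \<phi> -` A \<inter> \<phi> ` space M |A. A \<in> {U. openin X U}} = {U. openin Y U}"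
    proof -
      have "inv \<phi> -` A \<inter> \<phi> ` space M = \<phi> ` A" if "openin X A" for A
        using inj openin_subset[OF that] X(3) by (auto simp: image_iff)
      then show ?thesis unfolding openin_Y by (auto; metis)
    qed
    finally show ?thesis by simp
  qed
  then show ?thesis
    unfolding standard_borel_measure_def
    using X(1,2) topspace_Y homeomorphic_completely_metrizable_space[OF hom] homeomorphic_space_second_countability[OF hom]
    by (intro exI[of _ Y]) auto
qed

lemma mp_action_M':
  assumes "mp_action M T" shows "mp_action M' T'"
proof -
  have T: "T \<gamma> \<in> measurable M M" "distr M M (T \<gamma>) = M" if "\<gamma> \<in> H3Z" for \<gamma>
    using assms that unfolding mp_action_def by blast+
  have meas: "T' \<gamma> \<in> measurable M' M'" if "\<gamma> \<in> H3Z" for \<gamma>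
    unfolding M'_def
  proof (rule measurable_embed_measure1)
    show "(\<lambda>x. T' \<gamma> (\<phi> x)) \<in> measurable M (embed_measure M \<phi>)"
      using measurable_compose[OF T(1)[OF that] measurable_\<phi>] by (simp add: M'_def)
  qed
  have "distr M' M' (T' \<gamma>) = M'" if "\<gamma> \<in> H3Z" for \<gamma>
  proof -
    have "distr M' M' (T' \<gamma>) = distr (distr M M' \<phi>) M' (T' \<gamma>)"
      using M'_eq_distr by simp
    also have "\<dots> = distr M M' (\<phi> \<circ> T \<gamma>)"
      using meas[OF that] by (subst distr_distr) (auto simp: comp_def)
    also have "\<dots> = distr (distr M M (T \<gamma>)) M' \<phi>"
      using T(1)[OF that] by (subst distr_distr) auto
    also have "\<dots> = M'" using T(2)[OF that] M'_eq_distr by simp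
    finally show ?thesis .
  qed
  then show ?thesis
    using meas assms unfolding mp_action_def by auto
qed

lemma free_action_M': "free_action M T \<Longrightarrow> free_action M' T'"
  unfolding free_action_def M'_def AE_embed_measure[OF inj] using inj by (simp add: inj_eq)

lemma sym_diff_image: "sym_diff (\<phi> ` A) (\<phi> ` B) = \<phi> ` sym_diff A B"
  using inj by (simp add: image_Un image_set_diff)

lemma rank_one_M':
  assumes "rank_one M T" and T: "\<And>\<gamma> A. \<gamma> \<in> H3Z \<Longrightarrow> A \<in> sets M \<Longrightarrow> T \<gamma> ` A \<in> sets M"
  shows "rank_one M' T'"
proof -
  obtain F B where F: "Folner_sequence F"
    and B: "\<And>n. B n \<in> sets M" "\<And>n. 0 < emeasure M (B n)" "\<And>n. emeasure M (B n) < \<infinity>"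
    and disj: "\<And>n. disjoint_family_on (\<lambda>\<gamma>. T \<gamma> ` B n) (F n)"
    and lim: "\<And>A. A \<in> sets M \<Longrightarrow> emeasure M A < \<infinity> \<Longrightarrow>
       (\<lambda>n. Min ((\<lambda>F'. emeasure M (sym_diff A (\<Union>\<gamma>\<in>F'. T \<gamma> ` B n))) ` Pow (F n))) \<longlonglongrightarrow> 0"
    using assms(1) unfolding rank_one_def by blast
  have eq: "emeasure M' (sym_diff (\<phi> ` A) (\<Union>\<gamma>\<in>F'. T' \<gamma> ` \<phi> ` B n)) = emeasure M (sym_diff A (\<Union>\<gamma>\<in>F'. T \<gamma> ` B n))"
    if "F' \<in> Pow (F n)" "A \<in> sets M" for F' A n
  proof -
    have "finite F'" "F' \<subseteq> H3Z"
      using that(1) F unfolding Folner_sequence_def by (auto intro: finite_subset)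
    then have "(\<Union>\<gamma>\<in>F'. T \<gamma> ` B n) \<in> sets M"
      using T B(1) by (intro sets.finite_UN) auto
    moreover have "sym_diff (\<phi> ` A) (\<Union>\<gamma>\<in>F'. T' \<gamma> ` \<phi> ` B n) = \<phi> ` sym_diff A (\<Union>\<gamma>\<in>F'. T \<gamma> ` B n)"
      by (simp only: T'_image image_UN[symmetric] sym_diff_image)
    ultimately show ?thesis using that(2) by simp
  qed
  show ?thesis
    unfolding rank_one_def
  proof (intro exI conjI allI ballI impI)
    show "Folner_sequence F" by (rule F)
    show "\<phi> ` B n \<in> sets M'" for n using B(1) by (auto simp: sets_M')
    show "0 < emeasure M' (\<phi> ` B n)" "emeasure M' (\<phi> ` B n) < \<infinity>" for n using B by simp_all
    show "disjoint_family_on (\<lambda>\<gamma>. T' \<gamma> ` \<phi> ` B n) (F n)" for n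
      using disj[of n] unfolding disjoint_family_on_def T'_image
      by (simp only: image_Int[OF inj, symmetric] image_is_empty)
    fix A' assume "A' \<in> sets M'" "emeasure M' A' < \<infinity>"
    then obtain A where A: "A \<in> sets M" "A' = \<phi> ` A" "emeasure M A < \<infinity>" by (auto simp: sets_M')
    have "(\<lambda>F'. emeasure M' (sym_diff A' (\<Union>\<gamma>\<in>F'. T' \<gamma> ` \<phi> ` B n))) ` Pow (F n)
        = (\<lambda>F'. emeasure M (sym_diff A (\<Union>\<gamma>\<in>F'. T \<gamma> ` B n))) ` Pow (F n)" for n
      unfolding A(2) using eq A(1) by (intro image_cong) auto
    then show "(\<lambda>n. Min ((\<lambda>F'. emeasure M' (sym_diff A' (\<Union>\<gamma>\<in>F'. T' \<gamma> ` \<phi> ` B n))) ` Pow (F n))) \<longlonglongrightarrow> 0"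
      using lim[OF A(1,3)] by simp
  qed
qed

end

lemma coprime_moduli_primes: "coprime_moduli (\<lambda>n. int (enumerate {p. prime p} n))"
proof
  have inf: "infinite {p::nat. prime p}" by (rule primes_infinite)
  have prime: "prime (enumerate {p::nat. prime p} n)" for n
    using enumerate_in_set[OF inf] by simp
  show "1 < int (enumerate {p. prime p} i)" for i
    using prime_gt_1_nat[OF prime[of i]] by simp
  show "coprime (int (enumerate {p. prime p} i)) (int (enumerate {p. prime p} j))" if "i \<noteq> j" for i j
  proof -
    have "enumerate {p::nat. prime p} i \<noteq> enumerate {p. prime p} j"
      using inj_enumerate[OF inf] that by (simp add: inj_eq)
    then show ?thesis using primes_coprime[OF prime prime] by simp
  qed
qed

text \<open>A sequence is encoded by its graph, with \<open>k\<close> attached to every point so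
  that it can be recovered; sets of naturals are as many as the reals.\<close>

lemma ex_inj_to_real: "\<exists>\<phi> :: (nat \<Rightarrow> 'a::countable) \<times> 'b::countable \<Rightarrow> real. inj \<phi>"
proof -
  define \<psi> :: "(nat \<Rightarrow> 'a) \<times> 'b \<Rightarrow> nat set" where
    "\<psi> = (\<lambda>(y, k). range (\<lambda>i. to_nat (i, y i, k)))"
  have "inj \<psi>"
  proof (rule injI)
    fix x x' assume eq: "\<psi> x = \<psi> x'"
    obtain y k y' k' where [simp]: "x = (y, k)" "x' = (y', k')" by (cases x, cases x')
    have "y i = y' i \<and> k = k'" for i
    proof -
      have "to_nat (i, y i, k) \<in> \<psi> x'" unfolding eq[symmetric] by (auto simp: \<psi>_def)
      then show ?thesis by (auto simp: \<psi>_def)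
    qed
    then show "x = x'" by auto
  qed
  moreover obtain g :: "nat set \<Rightarrow> real" where "inj g"
    using nat_sets_eqpoll_reals unfolding eqpoll_def bij_betw_def by blast
  ultimately have "inj (g \<circ> \<psi>)" by (intro inj_compose)
  then show ?thesis by blast
qed

theorem theorem6p3:
  fixes d :: "real^3^3 \<Rightarrow> real^3^3 \<Rightarrow> real"
  assumes "right_invariant_compatible_metric d"
  shows "\<exists>(M :: real measure) (T :: real^3^3 \<Rightarrow> real \<Rightarrow> real).
    standard_borel_measure M \<and> sigma_finite_measure M \<and> mp_action M T \<and>
    emeasure M (space M) = \<infinity> \<and> free_action M T \<and> rank_one M T \<and>
    Rec d M T = range theta \<union> {theta_infinity} \<and>
    Rig d M T = range theta \<union> {theta_infinity} \<and>
    Even_Rec d M T = range theta \<union> {theta_infinity} \<and>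
    Even_Rig d M T = range theta \<union> {theta_infinity}"
proof -
  interpret right_invariant d using assms by unfold_locales
  interpret coprime_moduli "\<lambda>n. int (enumerate {p. prime p} n)" by (rule coprime_moduli_primes)
  obtain \<phi> :: "(nat \<Rightarrow> int \<times> int) \<times> int \<Rightarrow> real" where "inj \<phi>" using ex_inj_to_real by blast
  then interpret measure_embedding induced heis_act \<phi> by unfold_locales
  have sets_act: "heis_act \<gamma> ` A \<in> sets induced" if "A \<in> sets induced" for \<gamma> A
    unfolding heis_act_def using that by (rule act_image_sets)
  then have sets_T': "T' \<gamma> ` A \<in> sets M'" if "A \<in> sets M'" for \<gamma> A
    using that by (auto simp: sets_M')
  have sigma: "sigma_finite_measure M'"
    unfolding M'_def using sigma_finite_induced inj by (rule sigma_finite_embed_measure)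
  have infinite: "emeasure M' (space M') = \<infinity>"
    using emeasure_induced_UNIV_Times[of UNIV] sets.top[of induced] by simp
  \<comment> \<open>Fibre 0 has measure 1, and an element with (2,3) entry \<open>b\<close> carries
    it to fibre \<open>b\<close>, disjoint from it unless \<open>b = 0\<close>.\<close>
  let ?A = "\<phi> ` (UNIV \<times> {0})"
  have A0: "UNIV \<times> {0} \<in> sets induced" by (rule cyl_in_sets_induced[of 0]) (simp add: cyl_def)
  then have A: "?A \<in> sets M'" "emeasure M' ?A > 0"
    using emeasure_induced_UNIV_Times[of "{0}"] by (auto simp: sets_M')
  have wandering: "emeasure M' (?A \<inter> T' \<gamma> ` ?A) = 0" if "\<gamma> \<in> H3Z" "\<gamma>$2$3 \<noteq> 0" for \<gamma>
  proof -
    obtain a b c :: int where \<gamma>: "\<gamma> = heis (of_int a) (of_int b) (of_int c)" using \<open>\<gamma> \<in> H3Z\<close> by (rule H3Z_E)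
    then have "b \<noteq> 0" using that(2) by simp
    then have "(UNIV \<times> {0}) \<inter> heis_act \<gamma> ` (UNIV \<times> {0}) = {}" by (auto simp: \<gamma> act_def)
    then have "?A \<inter> T' \<gamma> ` ?A = {}"
      by (simp only: T'_image image_Int[OF inj, symmetric] image_empty)
    then show ?thesis by simp
  qed
  have rigid: "rigid_along d M' T' \<theta>" if "\<theta> \<in> range theta \<union> {theta_infinity}" for \<theta>
    using that h_pos
  proof (rule rigid_along_horizontal)
    show "\<forall>\<^sub>F n in sequentially. h n > N" for N
      using eventually_ge_at_top[of "nat N"]
    proof eventually_elim
      case (elim n)
      then show ?case using h_gt[of n] by linarith
    qed
  next
    fix a c :: "nat \<Rightarrow> int" and A'
    assume dvd: "\<And>n. h n dvd a n \<and> h n dvd c n" and "A' \<in> sets M'" "emeasure M' A' < \<infinity>"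
    then obtain A where A: "A \<in> sets induced" "A' = \<phi> ` A" "emeasure induced A < \<infinity>" by (auto simp: sets_M')
    have "emeasure M' (A' \<inter> T' (heis (of_int (a n)) 0 (of_int (c n))) ` A') = emeasure induced (A \<inter> act (a n) 0 (c n) ` A)" for n
      using A(1) act_image_sets[OF A(1)] heis_act_heis[of "a n" 0 "c n"]
      by (simp add: A(2) image_Int[OF inj, symmetric])
    then show "(\<lambda>n. emeasure M' (A' \<inter> T' (heis (of_int (a n)) 0 (of_int (c n))) ` A')) \<longlonglongrightarrow> emeasure M' A'"
      using rigid_induced[OF dvd A(1,3)] A(1,2) by simp
  qed
  note directional = directional_sets_eq_horizontal[OF A wandering sigma sets_T' rigid]
  show ?thesis
    by (intro exI[of _ M'] exI[of _ T'] conjI standard_borel_M'[OF standard_borel_induced] sigma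
        mp_action_M'[OF mp_action_induced] infinite free_action_M'[OF free_action_induced]
        rank_one_M'[OF rank_one_induced sets_act] directional)
qed

end
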